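(* Let $D$ be a strongly connected balanced bipartite digraph with partite sets $V_1,V_2$ with $|V_1|=|V_2|=a$, where $a\geq 3$. Suppose that $d(x)+d(y)\geq 3a$ for every pair of distinct vertices $x,y$ of $D$ which have a common in-neighbour or a common out-neighbour. Then $D$ is hamiltonian. Moreover, the only non-hamiltonian strongly connected balanced bipartite digraph on $4$ vertices (i.e. with $a=2$) satisfying $d(x)+d(y)\geq 3a$ for every pair of vertices $x,y$ with a common in-neighbour or a common out-neighbour is (up to isomorphism) the digraph obtained from the complete bipartite digraph $\stackrel{\leftrightarrow}{K}_{2,2}$ by removing one $2$-cycle (i.e. removing both arcs $uv$ and $vu$ for one pair $u\in V_1$, $v\in V_2$).
   Context: Digraphs are finite, with no loops and no multiple arcs. For a vertex $v$, $d^+(v)$ (resp. $d^-(v)$) is the number of out-neighbours (resp. in-neighbours) of $v$, and $d(v)=d^+(v)+d^-(v)$. An in-neighbour of $u$ is a vertex $v$ with $vu$ an arc; an out-neighbour of $u$ is a vertex $v$ with $uv$ an arc. A bipartite digraph has vertex set the disjoint union of two independent sets (partite sets); it is balanced if they have equal size. $\stackrel{\leftrightarrow}{K}_{2,2}$ is the bipartite digraph with partite sets of size $2$ containing both arcs $xy$ and $yx$ for all $x,y$ in different partite sets. A digraph is hamiltonian if it contains a directed cycle through all its vertices; it is strongly connected if for all vertices $u,v$ there is a directed path from $u$ to $v$. *)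

theory Defs
  imports "Graph_Theory.Graph_Theory"
begin

definition bipartition :: "('a,'b) pre_digraph \<Rightarrow> 'a set \<Rightarrow> 'a set \<Rightarrow> bool" where
  "bipartition G V\<^sub>1 V\<^sub>2 \<longleftrightarrow>
     verts G = V\<^sub>1 \<union> V\<^sub>2 \<and> V\<^sub>1 \<inter> V\<^sub>2 = {} \<and>
     (\<forall>u \<in> V\<^sub>1. \<forall>v \<in> V\<^sub>1. \<not> u \<rightarrow>\<^bsub>G\<^esub> v) \<and>
     (\<forall>u \<in> V\<^sub>2. \<forall>v \<in> V\<^sub>2. \<not> u \<rightarrow>\<^bsub>G\<^esub> v)"

text \<open>The library degrees count arcs; in a digraph without multiple arcs this is the same as
  counting neighbours.\<close>

definition total_degree :: "('a,'b) pre_digraph \<Rightarrow> 'a \<Rightarrow> nat" where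
  "total_degree G v = out_degree G v + in_degree G v"

definition common_in_neighbour :: "('a,'b) pre_digraph \<Rightarrow> 'a \<Rightarrow> 'a \<Rightarrow> bool" where
  "common_in_neighbour G x y \<longleftrightarrow> (\<exists>z \<in> verts G. z \<rightarrow>\<^bsub>G\<^esub> x \<and> z \<rightarrow>\<^bsub>G\<^esub> y)"

definition common_out_neighbour :: "('a,'b) pre_digraph \<Rightarrow> 'a \<Rightarrow> 'a \<Rightarrow> bool" where
  "common_out_neighbour G x y \<longleftrightarrow> (\<exists>z \<in> verts G. x \<rightarrow>\<^bsub>G\<^esub> z \<and> y \<rightarrow>\<^bsub>G\<^esub> z)"

definition degree_sum_condition :: "('a,'b) pre_digraph \<Rightarrow> nat \<Rightarrow> bool" where
  "degree_sum_condition G a \<longleftrightarrow>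
     (\<forall>x \<in> verts G. \<forall>y \<in> verts G.
        x \<noteq> y \<and> (common_in_neighbour G x y \<or> common_out_neighbour G x y) \<longrightarrow>
        total_degree G x + total_degree G y \<ge> 3 * a)"

definition hamiltonian :: "('a,'b) pre_digraph \<Rightarrow> bool" where
  "hamiltonian G \<longleftrightarrow>
     (\<exists>u p. pre_digraph.cycle G p \<and> pre_digraph.awalk G u p u \<and>
            set (pre_digraph.awalk_verts G u p) = verts G)"

definition K22 :: "nat pair_pre_digraph" where
  "K22 = \<lparr> pverts = {0, 1} \<union> {2, 3}, parcs = {0, 1} \<times> {2, 3} \<union> {2, 3} \<times> {0, 1} \<rparr>"

definition K22_minus_2cycle :: "nat pair_pre_digraph" where
  "K22_minus_2cycle = \<lparr> pverts = pverts K22, parcs = parcs K22 - {(0, 2), (2, 0)} \<rparr>"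

lemma K22_complete_bipartite: "complete_bipartite_digraph 2 2 (with_proj K22)"
  unfolding complete_bipartite_digraph_pair_def
  by (intro conjI exI[of _ "{0, 1}"] exI[of _ "{2, 3}"]) (auto simp: K22_def)

end

theory Submission
  imports Defs "HOL-Combinatorics.Orbits"
begin

text \<open>
  The degree condition yields Hall's condition in both directions, hence a cycle factor \<open>f\<close>.
  Choose \<open>f\<close> with the orbit of a fixed vertex as large as possible, and suppose that orbit is not
  everything. Let \<open>C\<close> be the smaller of the orbit and its complement, with \<open>s \<le> a/2\<close> vertices in each
  part. For \<open>p\<close> inside and \<open>q\<close> outside \<open>C\<close> the arcs \<open>p \<rightarrow> f q\<close> and \<open>q \<rightarrow> f p\<close> cannot both exist, since
  exchanging successors would enlarge the orbit; so at most half of the possible arcs between \<open>C\<close> and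
  its complement are present, and one part of \<open>C\<close> has average degree at most \<open>a + s \<le> 3a/2\<close>.

  On the other hand every vertex shares a neighbour with another one (otherwise the digraph is a
  directed cycle), so all degrees are at least \<open>a\<close>. A part contains at most two vertices of degree
  below \<open>3a/2\<close>; two such vertices have degree \<open>a\<close> and all others in the part are joined to everything.
  Comparing these bounds gives a contradiction or forces \<open>C\<close> and its complement to induce complete bipartite digraphs. Then
  \<open>f\<close> can be rerouted freely inside both, and strong connectivity produces a mergeable pair unless
  \<open>a = 2\<close>, where the only obstruction is a bidirected path on four vertices.
\<close>
section \<open>Cycle factors\<close>

text \<open>The induction of Halmos and Vaughan: if every nonempty proper subfamily has a spare
  element, any value \<open>y\<close> of one index can be fixed and removed. Otherwise a tight
  \<open>J\<close> is matched within its own union, and the other indices avoid that union.\<close>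

lemma Hall_marriage:
  fixes N :: "'i \<Rightarrow> 'v set"
  assumes "finite I" and "\<And>i. i \<in> I \<Longrightarrow> finite (N i)"
    and "\<And>J. J \<subseteq> I \<Longrightarrow> card J \<le> card (\<Union>i\<in>J. N i)"
  shows "\<exists>f. inj_on f I \<and> (\<forall>i\<in>I. f i \<in> N i)"
  using assms
proof (induction "card I" arbitrary: I N rule: less_induct)
  case less
  note finI = less.prems(1) and finN = less.prems(2) and hall = less.prems(3)
  have finU: "finite (\<Union>i\<in>J. N i)" if "J \<subseteq> I" for J
    using that finite_subset[OF that finI] finN by auto
  consider "I = {}"
    | (slack) "I \<noteq> {}" "\<And>J. J \<noteq> {} \<Longrightarrow> J \<subset> I \<Longrightarrow> card J < card (\<Union>i\<in>J. N i)"
    | (tight) J where "J \<noteq> {}" "J \<subset> I" "card (\<Union>i\<in>J. N i) \<le> card J"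
    by (meson not_less)
  then show ?case
  proof cases
    case 1
    then show ?thesis by simp
  next
    case slack
    then obtain i where i: "i \<in> I" by blast
    have "N i \<noteq> {}" using hall[of "{i}"] i by auto
    then obtain y where y: "y \<in> N i" by blast
    have "\<exists>f. inj_on f (I - {i}) \<and> (\<forall>j\<in>I - {i}. f j \<in> N j - {y})"
    proof (rule less.hyps)
      show "card (I - {i}) < card I" using finI i by (rule card_Diff1_less)
      fix J assume J: "J \<subseteq> I - {i}"
      show "card J \<le> card (\<Union>j\<in>J. N j - {y})"
      proof (cases "J = {}")
        case False
        then have "card J < card (\<Union>j\<in>J. N j)" using slack(2)[of J] J i by blast
        moreover have "card (\<Union>j\<in>J. N j) - 1 \<le> card ((\<Union>j\<in>J. N j) - {y})"
          by (simp add: card_Diff_singleton_if)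
        moreover have "(\<Union>j\<in>J. N j - {y}) = (\<Union>j\<in>J. N j) - {y}" by blast
        ultimately show ?thesis by simp
      qed simp
    qed (use finI finN in auto)
    then obtain f where f: "inj_on f (I - {i})" "\<forall>j\<in>I - {i}. f j \<in> N j - {y}" by blast
    have "inj_on (f(i := y)) I"
      using f by (auto simp: inj_on_def)
    then show ?thesis using f y by (intro exI[of _ "f(i := y)"]) auto
  next
    case tight
    let ?U = "\<Union>i\<in>J. N i"
    have finJ: "finite J" using tight finI by (meson finite_subset psubsetE)
    have "\<exists>f. inj_on f J \<and> (\<forall>i\<in>J. f i \<in> N i)"
    proof (rule less.hyps)
      show "card J < card I" using tight finI by (simp add: psubset_card_mono)
      show "\<And>K. K \<subseteq> J \<Longrightarrow> card K \<le> card (\<Union>i\<in>K. N i)"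
        using hall tight by (meson psubsetE subset_trans)
    qed (use finJ finN tight in auto)
    then obtain f where f: "inj_on f J" "\<forall>i\<in>J. f i \<in> N i" by blast
    have "\<exists>g. inj_on g (I - J) \<and> (\<forall>i\<in>I - J. g i \<in> N i - ?U)"
    proof (rule less.hyps)
      show "card (I - J) < card I" using tight finI
        by (intro psubset_card_mono) auto
      \<comment> \<open>Hall's condition for \<open>K \<union> J\<close> minus the tight count for
        \<open>J\<close> leaves enough values outside \<open>?U\<close>.\<close>
      fix K assume K: "K \<subseteq> I - J"
      have finK: "finite K" using K finI finite_subset by blast
      have "card K + card J = card (K \<union> J)"
        using K finK finJ by (subst card_Un_disjoint) auto
      also have "\<dots> \<le> card (\<Union>i\<in>K \<union> J. N i)" using hall[of "K \<union> J"] K tight by blast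
      also have "(\<Union>i\<in>K \<union> J. N i) = (\<Union>i\<in>K. N i - ?U) \<union> ?U" by auto
      also have "card \<dots> = card (\<Union>i\<in>K. N i - ?U) + card ?U"
      proof (rule card_Un_disjoint)
        show "finite (\<Union>i\<in>K. N i - ?U)"
          using K by (intro finite_subset[OF _ finU[of K]]) auto
        show "finite ?U" using finU[of J] tight by blast
      qed auto
      finally show "card K \<le> card (\<Union>i\<in>K. N i - ?U)" using tight(3) by linarith
    qed (use finI finN in auto)
    then obtain g where g: "inj_on g (I - J)" "\<forall>i\<in>I - J. g i \<in> N i - ?U" by blast
    let ?h = "\<lambda>i. if i \<in> J then f i else g i"
    have "inj_on ?h I"
    proof -
      have "inj_on ?h J" using f(1) by (simp add: inj_on_def)
      moreover have "inj_on ?h (I - J)" using g(1) by (simp add: inj_on_def)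
      moreover have "?h ` J \<subseteq> ?U" using f(2) by auto
      moreover have "?h ` (I - J) \<inter> ?U = {}" using g(2) by auto
      ultimately have "inj_on ?h (J \<union> (I - J))" unfolding inj_on_Un by blast
      then show ?thesis using tight(2) by (simp add: Un_absorb1 psubset_imp_subset)
    qed
    moreover have "\<forall>i\<in>I. ?h i \<in> N i" using f(2) g(2) by simp
    ultimately show ?thesis by blast
  qed
qed

text \<open>The exchange splices two cycles into one: the new orbit leaves \<open>p\<close> for
  \<open>f q\<close>, runs round the cycle of \<open>q\<close> back to \<open>q\<close>, and
  continues at \<open>f p\<close>.\<close>

lemma orbit_comp_transpose_psubset:
  assumes f: "f permutes V" and fin: "finite V"
    and p: "p \<in> orbit f v" and q: "q \<notin> orbit f v" and pq: "p \<in> V" "q \<in> V"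
  shows "orbit f v \<subset> orbit (f \<circ> transpose p q) v"
proof -
  define g where "g = f \<circ> transpose p q"
  let ?O = "orbit g v"
  have g_p: "g p = f q" and g_q: "g q = f p" and g_other: "\<And>w. w \<noteq> p \<Longrightarrow> w \<noteq> q \<Longrightarrow> g w = f w"
    by (simp_all add: g_def)
  have g: "g permutes V"
    unfolding g_def using f pq by (intro permutes_compose permutes_swap_id) auto
  have pf: "permutation f" and pg: "permutation g"
    using f g fin by (auto simp: permutation_permutes)
  have step: "g w \<in> ?O" if "w \<in> ?O" for w using that by (rule orbit.step)
  have p_notin: "p \<notin> orbit f q"
    using p q pf by (meson orbit_swap orbit_trans permutation_self_in_orbit)
  \<comment> \<open>On the cycle of \<open>q\<close> the maps \<open>f\<close> and \<open>g\<close>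
    differ only at \<open>q\<close>, whose successor \<open>f q\<close> is in the new orbit by
    assumption; \<open>p\<close> does not occur there.\<close>
  have fq_imp: "w \<in> ?O" if "f q \<in> ?O" "w \<in> orbit f q" for w
    using that(2)
  proof induction
    case base then show ?case by (rule that(1))
  next
    case (step z)
    then show ?case
      using orbit.step[of z g v] p_notin that(1) g_other[of z]
      by (cases "z = q"; cases "z = p") simp_all
  qed
  have clos: "f w \<in> ?O" if "w \<in> orbit f v" "w \<in> ?O" for w
  proof (cases "w = p")
    case True
    then have "f q \<in> ?O" using step[OF that(2)] g_p by simp
    then have "q \<in> ?O" using fq_imp permutation_self_in_orbit[OF pf] by blast
    from step[OF this] show ?thesis using True g_q by simp
  next
    case False
    moreover have "w \<noteq> q" using that q by blast
    ultimately show ?thesis using step[OF that(2)] g_other by simp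
  qed
  have sub: "w \<in> ?O" if "w \<in> orbit f v" for w
    using that
  proof induction
    case base
    then show ?case by (intro clos) (simp_all add: pf pg permutation_self_in_orbit)
  next
    case (step y)
    then show ?case by (intro clos)
  qed
  have "f q \<in> ?O" using step[OF sub[OF p]] g_p by simp
  moreover have "f q \<notin> orbit f v"
    using q f cyclic_on_f_in cyclic_on_orbit[OF f fin] by metis
  ultimately show ?thesis using sub unfolding g_def by blast
qed

text \<open>Encodes a spanning family of disjoint directed cycles by its successor map; the orbits
  are the cycles.\<close>

definition cycle_factor :: "'a set \<Rightarrow> ('a \<times> 'a) set \<Rightarrow> ('a \<Rightarrow> 'a) \<Rightarrow> bool" where
  "cycle_factor V E f \<longleftrightarrow> f permutes V \<and> (\<forall>v\<in>V. (v, f v) \<in> E)"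

text \<open>\<open>C\<close> may be any union of cycles of \<open>f\<close>, which makes the notion
  symmetric between \<open>C\<close> and its complement. The last clause says that no exchange of
  successors across \<open>C\<close> is available.\<close>

definition unmergeable :: "'a set \<Rightarrow> ('a \<times> 'a) set \<Rightarrow> ('a \<Rightarrow> 'a) \<Rightarrow> 'a set \<Rightarrow> bool" where
  "unmergeable V E f C \<longleftrightarrow> cycle_factor V E f \<and> C \<subseteq> V \<and> C \<noteq> {} \<and> C \<noteq> V \<and> f ` C = C \<and>
     (\<forall>p\<in>C. \<forall>q\<in>V - C. \<not> ((p, f q) \<in> E \<and> (q, f p) \<in> E))"

text \<open>A conjugate by a \<open>\<tau>\<close> that maps \<open>C\<close> to itself has the same orbit sizes as \<open>f\<close>, so it is
  equally optimal; this is what allows rerouting inside \<open>C\<close> and inside its complement.\<close>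

definition robustly_unmergeable ::
    "'a set \<Rightarrow> ('a \<times> 'a) set \<Rightarrow> ('a \<Rightarrow> 'a) \<Rightarrow> 'a set \<Rightarrow> bool" where
  "robustly_unmergeable V E f C \<longleftrightarrow> unmergeable V E f C \<and>
     (\<forall>\<tau>. \<tau> permutes V \<and> \<tau> ` C = C \<and> cycle_factor V E (\<tau> \<circ> f \<circ> inv \<tau>)
        \<longrightarrow> unmergeable V E (\<tau> \<circ> f \<circ> inv \<tau>) C)"

lemma permutes_image_Diff:
  assumes "f permutes V" "f ` C = C"
  shows "f ` (V - C) = V - C"
  using assms by (simp add: image_set_diff permutes_image permutes_inj)

lemma unmergeable_Diff:
  assumes "unmergeable V E f C"
  shows "unmergeable V E f (V - C)"
proof -
  have "f permutes V" "f ` C = C" using assms by (auto simp: unmergeable_def cycle_factor_def)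
  from permutes_image_Diff[OF this] show ?thesis
    using assms unfolding unmergeable_def by auto
qed

lemma robustly_unmergeable_Diff:
  assumes "robustly_unmergeable V E f C"
  shows "robustly_unmergeable V E f (V - C)"
proof -
  have C: "C \<subseteq> V" using assms by (auto simp: robustly_unmergeable_def unmergeable_def)
  have "\<tau> ` C = C" if "\<tau> permutes V" "\<tau> ` (V - C) = V - C" for \<tau>
    using permutes_image_Diff[OF that] C by (simp add: double_diff)
  then show ?thesis
    using assms unfolding robustly_unmergeable_def by (simp add: unmergeable_Diff)
qed

text \<open>Take a factor that maximizes the orbit of a fixed \<open>v\<close>: merging across that
  orbit would enlarge it. By symmetry under complement the smaller side can serve as
  \<open>C\<close>.\<close>

lemma ex_robustly_unmergeable:
  assumes fin: "finite V" and ne: "V \<noteq> {}" and "cycle_factor V E f0"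
    and no_ham: "\<not> (\<exists>f. cycle_factor V E f \<and> cyclic_on f V)"
  shows "\<exists>f C. robustly_unmergeable V E f C \<and> 2 * card C \<le> card V"
proof -
  obtain v where v: "v \<in> V" using ne by blast
  define P where "P f \<longleftrightarrow> cycle_factor V E f" for f
  have perm: "f permutes V" if "P f" for f using that by (simp add: P_def cycle_factor_def)
  have sub: "orbit f v \<subseteq> V" if "P f" for f
    using permutes_orbit_subset[OF perm[OF that] v] .
  have "P f0" using assms by (simp add: P_def)
  moreover have "\<forall>f. P f \<longrightarrow> card (orbit f v) < Suc (card V)"
    using sub fin by (auto simp: less_Suc_eq_le intro: card_mono)
  ultimately have "\<exists>f. P f \<and> (\<forall>g. P g \<longrightarrow> card (orbit g v) \<le> card (orbit f v))"
    by (rule Lattices_Big.ex_has_greatest_nat)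
  then obtain f where f: "P f" and max: "\<And>g. P g \<Longrightarrow> card (orbit g v) \<le> card (orbit f v)"
    by blast
  define C where "C = orbit f v"
  have cyc: "cyclic_on g (orbit g v)" if "P g" for g
    using cyclic_on_orbit[OF perm[OF that] fin] .
  have C: "C \<subseteq> V" "v \<in> C" "C \<noteq> V"
  proof -
    show "C \<subseteq> V" using sub[OF f] C_def by simp
    show "v \<in> C" unfolding C_def
      using perm[OF f] fin by (intro permutation_self_in_orbit) (auto simp: permutation_permutes)
    show "C \<noteq> V" using no_ham f cyc[OF f] unfolding C_def P_def by auto
  qed
  \<comment> \<open>Stated for every factor in which \<open>v\<close> has the orbit
    \<open>C\<close>: each of them is a maximizer too, so conjugates of \<open>f\<close> are
    covered.\<close>
  have unm: "unmergeable V E g C" if g: "P g" "orbit g v = C" for g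
    unfolding unmergeable_def
  proof (intro conjI ballI)
    show "cycle_factor V E g" using g P_def by simp
    show "g ` C = C"
    proof (rule card_subset_eq)
      show "finite C" using C fin finite_subset by blast
      show "g ` C \<subseteq> C" using g(2) orbit.step by (auto intro: orbit.step)
      show "card (g ` C) = card C"
        by (rule card_image, rule permutes_inj_on[OF perm[OF g(1)]])
    qed
    fix p q assume p: "p \<in> C" and q: "q \<in> V - C"
    show "\<not> ((p, g q) \<in> E \<and> (q, g p) \<in> E)"
    proof
      assume arcs: "(p, g q) \<in> E \<and> (q, g p) \<in> E"
      have "P (g \<circ> transpose p q)"
        unfolding P_def cycle_factor_def
      proof
        show "(g \<circ> transpose p q) permutes V"
          using perm[OF g(1)] p q C by (intro permutes_compose permutes_swap_id) auto
        show "\<forall>w\<in>V. (w, (g \<circ> transpose p q) w) \<in> E"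
          using g(1) arcs by (auto simp: P_def cycle_factor_def transpose_def)
      qed
      moreover have "orbit g v \<subset> orbit (g \<circ> transpose p q) v"
        using p q C(1) g(2) by (intro orbit_comp_transpose_psubset[OF perm[OF g(1)] fin]) auto
      ultimately have "card (orbit g v) < card (orbit (g \<circ> transpose p q) v)"
        using psubset_card_mono[OF finite_subset[OF sub fin]] by blast
      with max[OF \<open>P (g \<circ> transpose p q)\<close>] show False unfolding g(2) C_def by linarith
    qed
  qed (use C in auto)
  have "robustly_unmergeable V E f C"
    unfolding robustly_unmergeable_def
  proof (intro conjI allI impI)
    show "unmergeable V E f C" by (rule unm[OF f C_def[symmetric]])
    fix \<tau> assume \<tau>: "\<tau> permutes V \<and> \<tau> ` C = C \<and> cycle_factor V E (\<tau> \<circ> f \<circ> inv \<tau>)"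
    have "cyclic_on (\<tau> \<circ> f \<circ> inv \<tau>) (\<tau> ` C)"
      using cyc[OF f] \<tau> unfolding C_def
      by (intro cyclic_on_image[where f = f]) (auto simp: permutes_inverses)
    then have "orbit (\<tau> \<circ> f \<circ> inv \<tau>) v = C"
      using \<tau> C(2) by (simp add: orbit_cyclic_eq3)
    then show "unmergeable V E (\<tau> \<circ> f \<circ> inv \<tau>) C"
      using unm[of "\<tau> \<circ> f \<circ> inv \<tau>"] \<tau> unfolding P_def by blast
  qed
  moreover have "card C + card (V - C) = card V"
    using C(1) fin by (simp add: card_Diff_subset card_mono finite_subset)
  moreover have "2 * card C \<le> card V \<or> 2 * card (V - C) \<le> card V"
    using calculation(2) by linarith
  ultimately show ?thesis
    using robustly_unmergeable_Diff[of V E f C] by blast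
qed

section \<open>Strong balanced bipartite digraphs\<close>

definition deg :: "('a \<times> 'a) set \<Rightarrow> 'a \<Rightarrow> nat" where
  "deg E v = card (E `` {v}) + card (E\<inverse> `` {v})"

definition partners :: "('a \<times> 'a) set \<Rightarrow> 'a \<Rightarrow> 'a \<Rightarrow> bool" where
  "partners E x y \<longleftrightarrow> x \<noteq> y \<and> (\<exists>z. (z, x) \<in> E \<and> (z, y) \<in> E \<or> (x, z) \<in> E \<and> (y, z) \<in> E)"

definition num_arcs :: "('a \<times> 'a) set \<Rightarrow> 'a set \<Rightarrow> 'a set \<Rightarrow> nat" where
  "num_arcs E X Y = card (E \<inter> X \<times> Y)"

lemma num_arcs_le: "finite X \<Longrightarrow> finite Y \<Longrightarrow> num_arcs E X Y \<le> card X * card Y"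
  unfolding num_arcs_def by (metis card_cartesian_product card_mono finite_SigmaI inf_le2)

lemma num_arcs_complete:
  assumes "finite X" "finite Y" "card X * card Y \<le> num_arcs E X Y"
  shows "X \<times> Y \<subseteq> E"
proof -
  have "E \<inter> X \<times> Y = X \<times> Y"
    using assms num_arcs_le[OF assms(1,2), of E]
    by (intro card_subset_eq) (auto simp: num_arcs_def card_cartesian_product)
  then show ?thesis by blast
qed

lemma num_arcs_Un_right:
  assumes "finite X" "finite Y" "finite Z" "Y \<inter> Z = {}"
  shows "num_arcs E X (Y \<union> Z) = num_arcs E X Y + num_arcs E X Z"
proof -
  have "E \<inter> X \<times> (Y \<union> Z) = (E \<inter> X \<times> Y) \<union> (E \<inter> X \<times> Z)" by blast
  then show ?thesis
    unfolding num_arcs_def using assms by (simp, subst card_Un_disjoint) auto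
qed

lemma num_arcs_converse: "num_arcs (E\<inverse>) X Y = num_arcs E Y X"
proof -
  have "E\<inverse> \<inter> X \<times> Y = (E \<inter> Y \<times> X)\<inverse>" by blast
  then show ?thesis by (simp add: num_arcs_def)
qed

lemma num_arcs_Un_left:
  assumes "finite X" "finite Y" "finite Z" "Y \<inter> Z = {}"
  shows "num_arcs E (Y \<union> Z) X = num_arcs E Y X + num_arcs E Z X"
  using num_arcs_Un_right[OF assms, of "E\<inverse>"] by (simp add: num_arcs_converse)

lemma sum_card_Image_eq_num_arcs:
  assumes "finite X" "finite Y" "\<And>v. v \<in> X \<Longrightarrow> E `` {v} \<subseteq> Y"
  shows "(\<Sum>v\<in>X. card (E `` {v})) = num_arcs E X Y"
proof -
  have "E \<inter> X \<times> Y = Sigma X (\<lambda>v. E `` {v})" using assms(3) by blast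
  moreover have "finite (E `` {v})" if "v \<in> X" for v
    using that assms finite_subset by blast
  ultimately show ?thesis
    unfolding num_arcs_def using assms(1) by (simp add: card_SigmaI)
qed

text \<open>The hypotheses for the bare arc relation, symmetric in the two parts. The bound is only
  \<open>2 \<le> a\<close>, so that the four-vertex case shares the construction of a cycle
  factor.\<close>

locale balanced_bipartite =
  fixes A B :: "'a set" and E :: "('a \<times> 'a) set" and a :: nat
  assumes finite_A: "finite A" and finite_B: "finite B" and disjoint: "A \<inter> B = {}"
    and card_A: "card A = a" and card_B: "card B = a" and a_ge_2: "2 \<le> a"
    and arcs_sub: "E \<subseteq> A \<times> B \<union> B \<times> A"
    and strong: "\<And>u v. u \<in> A \<union> B \<Longrightarrow> v \<in> A \<union> B \<Longrightarrow> (u, v) \<in> E\<^sup>*"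
    and partners_deg: "\<And>x y. partners E x y \<Longrightarrow> 3 * a \<le> deg E x + deg E y"
begin

abbreviation V where "V \<equiv> A \<union> B"

lemma swap: "balanced_bipartite B A E a"
  using finite_A finite_B disjoint card_A card_B a_ge_2 arcs_sub strong partners_deg
  by unfold_locales (auto simp: Un_commute)

lemma finite_V: "finite V"
  using finite_A finite_B by simp

lemma arc_A: "v \<in> A \<Longrightarrow> (v, w) \<in> E \<Longrightarrow> w \<in> B" "v \<in> A \<Longrightarrow> (w, v) \<in> E \<Longrightarrow> w \<in> B"
  using arcs_sub disjoint by auto

lemma arc_B: "v \<in> B \<Longrightarrow> (v, w) \<in> E \<Longrightarrow> w \<in> A" "v \<in> B \<Longrightarrow> (w, v) \<in> E \<Longrightarrow> w \<in> A"
  using arcs_sub disjoint by auto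

lemma arc_V: "(v, w) \<in> E \<Longrightarrow> v \<in> V" "(v, w) \<in> E \<Longrightarrow> w \<in> V"
  using arcs_sub by auto

lemma neighbours_A: "v \<in> A \<Longrightarrow> E `` {v} \<subseteq> B" "v \<in> A \<Longrightarrow> E\<inverse> `` {v} \<subseteq> B"
  using arc_A by auto

lemma neighbours_B: "v \<in> B \<Longrightarrow> E `` {v} \<subseteq> A" "v \<in> B \<Longrightarrow> E\<inverse> `` {v} \<subseteq> A"
  using arc_B by auto

lemma finite_neighbours: "finite (E `` X)" "finite (E\<inverse> `` X)"
  by (rule finite_subset[OF _ finite_V], use arc_V in blast)+

lemma half_degree_le: "v \<in> V \<Longrightarrow> card (E `` {v}) \<le> a" "v \<in> V \<Longrightarrow> card (E\<inverse> `` {v}) \<le> a"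
  using neighbours_A neighbours_B card_A card_B finite_A finite_B
  by (metis Un_iff card_mono)+

lemma deg_le: "v \<in> V \<Longrightarrow> deg E v \<le> 2 * a"
  using half_degree_le[of v] by (simp add: deg_def)

lemma sum_deg:
  assumes "X \<subseteq> A"
  shows "(\<Sum>v\<in>X. deg E v) = num_arcs E X B + num_arcs E B X"
proof -
  have X: "finite X" using assms finite_A finite_subset by blast
  have "(\<Sum>v\<in>X. card (E `` {v})) = num_arcs E X B"
    using X finite_B neighbours_A assms by (intro sum_card_Image_eq_num_arcs) auto
  moreover have "(\<Sum>v\<in>X. card (E\<inverse> `` {v})) = num_arcs (E\<inverse>) X B"
    using X finite_B neighbours_A assms by (intro sum_card_Image_eq_num_arcs) auto
  ultimately show ?thesis by (simp add: deg_def sum.distrib num_arcs_converse)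
qed

text \<open>Otherwise induction along a path from \<open>s\<close> to \<open>t\<close> would never
  leave \<open>S\<close>.\<close>

lemma exit_arc:
  assumes "S \<subseteq> V" "S \<noteq> {}" "S \<noteq> V"
  obtains u v where "u \<in> S" "v \<in> V - S" "(u, v) \<in> E"
proof -
  obtain s t where st: "s \<in> S" "t \<in> V - S" using assms by blast
  have "\<exists>u v. u \<in> S \<and> v \<in> V - S \<and> (u, v) \<in> E"
  proof (rule ccontr)
    assume none: "\<not> ?thesis"
    have "(s, t) \<in> E\<^sup>*" using st assms strong by blast
    then have "t \<in> S"
    proof induction
      case (step y z)
      then show ?case using none arc_V(2) by blast
    qed (use st in simp)
    then show False using st by blast
  qed
  then show ?thesis using that by blast
qed

lemma card_V: "card V = 2 * a"
  using card_A card_B finite_A finite_B disjoint by (simp add: card_Un_disjoint)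

lemma singleton_neq_V: "{v} \<noteq> V"
proof
  assume "{v} = V"
  then have "card {v} = 2 * a" using card_V by (simp only:)
  then show False using a_ge_2 by simp
qed

lemma ex_out_neighbour:
  assumes "v \<in> V"
  obtains w where "(v, w) \<in> E"
proof -
  have "{v} \<subseteq> V" "{v} \<noteq> {}" using assms by auto
  then show ?thesis using exit_arc[OF _ _ singleton_neq_V[of v]] that by blast
qed

lemma ex_in_neighbour:
  assumes "v \<in> V"
  obtains w where "(w, v) \<in> E"
proof -
  have "V - {v} \<noteq> {}" "V - {v} \<noteq> V" using assms singleton_neq_V[of v] by auto
  then show ?thesis using exit_arc[of "V - {v}"] that by blast
qed

text \<open>Suppose \<open>S\<close> has only n < \<open>card S\<close> out-neighbours. By
  pigeonhole two vertices of \<open>S\<close> share one; their out-degrees are at most n, so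
  \<open>partners_deg\<close> gives \<open>a\<close> \<le> 2n. Dually, \<open>B\<close> has more
  vertices outside the out-neighbourhood than \<open>A - S\<close> has vertices, so two of them
  share an in-neighbour, which gives \<open>2 * card S \<le> a\<close>. Together
  \<open>card S\<close> \<le> n, a contradiction.\<close>

lemma card_le_card_out_neighbours:
  assumes S: "S \<subseteq> A"
  shows "card S \<le> card (E `` S)"
proof (rule ccontr)
  assume "\<not> ?thesis"
  then have less: "card (E `` S) < card S" by simp
  have ES: "E `` S \<subseteq> B" using S arc_A by blast
  have finS: "finite S" using S finite_A finite_subset by blast
  have "\<exists>h. \<forall>v\<in>S. (v, h v) \<in> E"
    using S by (intro bchoice ballI) (meson UnI1 ex_out_neighbour subsetD)
  then obtain h where h: "\<forall>v\<in>S. (v, h v) \<in> E" by blast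
  have "\<not> inj_on h S"
  proof (rule pigeonhole)
    have "card (h ` S) \<le> card (E `` S)"
      using h finite_neighbours by (intro card_mono) auto
    with less show "card S > card (h ` S)" by simp
  qed
  then obtain x y where xy: "x \<in> S" "y \<in> S" "x \<noteq> y" "h x = h y" by (auto simp: inj_on_def)
  then have "partners E x y" using h unfolding partners_def by metis
  moreover have half: "deg E x \<le> card (E `` S) + a" if "x \<in> S" for x
  proof -
    have "card (E `` {x}) \<le> card (E `` S)"
      using that finite_neighbours by (intro card_mono) auto
    then show ?thesis using half_degree_le(2)[of x] that S by (auto simp: deg_def)
  qed
  ultimately have 1: "a \<le> 2 * card (E `` S)"
    using partners_deg[of x y] half[OF xy(1)] half[OF xy(2)] by linarith
  let ?T = "B - E `` S"
  have "\<exists>g. \<forall>t\<in>?T. (g t, t) \<in> E"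
    by (intro bchoice ballI) (meson DiffD1 UnI2 ex_in_neighbour)
  then obtain g where g: "\<forall>t\<in>?T. (g t, t) \<in> E" by blast
  have in_T: "E\<inverse> `` {t} \<subseteq> A - S" if "t \<in> ?T" for t
    using that arc_B by blast
  have cardT: "card ?T = a - card (E `` S)"
    using ES finite_B card_B finite_neighbours by (simp add: card_Diff_subset)
  have cardAS: "card (A - S) = a - card S"
    using S finS card_A by (simp add: card_Diff_subset)
  have "card S \<le> a" using S finite_A card_A card_mono by metis
  have "\<not> inj_on g ?T"
  proof (rule pigeonhole)
    have "card (g ` ?T) \<le> card (A - S)"
      using g in_T finite_A by (intro card_mono) auto
    also have "\<dots> < card ?T" using cardT cardAS less \<open>card S \<le> a\<close> by linarith
    finally show "card ?T > card (g ` ?T)" .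
  qed
  then obtain s t where st: "s \<in> ?T" "t \<in> ?T" "s \<noteq> t" "g s = g t" by (auto simp: inj_on_def)
  then have "partners E s t" using g unfolding partners_def by metis
  moreover have half': "deg E t \<le> a + (a - card S)" if "t \<in> ?T" for t
  proof -
    have "card (E\<inverse> `` {t}) \<le> card (A - S)"
      using in_T[OF that] finite_A by (intro card_mono) auto
    then show ?thesis using half_degree_le(1)[of t] that cardAS by (auto simp: deg_def)
  qed
  ultimately have "2 * card S \<le> a"
    using partners_deg[of s t] half'[OF st(1)] half'[OF st(2)] \<open>card S \<le> a\<close> by linarith
  then show False using 1 less by linarith
qed

text \<open>Out-neighbours of the two parts lie in opposite parts, so the two Hall inequalities add
  up. An injective choice of out-neighbours on a finite vertex set is a permutation.\<close>

lemma ex_cycle_factor: "\<exists>f. cycle_factor V E f"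
proof -
  have hall: "card J \<le> card (\<Union>v\<in>J. E `` {v})" if J: "J \<subseteq> V" for J
  proof -
    interpret sw: balanced_bipartite B A E a by (rule swap)
    have "card J = card (J \<inter> A) + card (J \<inter> B)"
      using J disjoint finite_A finite_B
      by (subst card_Un_disjoint[symmetric]) (auto intro: arg_cong[where f = card])
    also have "\<dots> \<le> card (E `` (J \<inter> A)) + card (E `` (J \<inter> B))"
      by (intro add_mono card_le_card_out_neighbours sw.card_le_card_out_neighbours) auto
    also have "\<dots> = card (E `` (J \<inter> A) \<union> E `` (J \<inter> B))"
      using disjoint arc_A arc_B finite_neighbours by (subst card_Un_disjoint) blast+
    also have "\<dots> \<le> card (\<Union>v\<in>J. E `` {v})"
      using finite_neighbours(1)[of J] by (intro card_mono) (auto simp: Image_eq_UN[symmetric])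
    finally show ?thesis .
  qed
  have "\<exists>f. inj_on f V \<and> (\<forall>v\<in>V. f v \<in> E `` {v})"
    by (rule Hall_marriage[OF finite_V finite_neighbours(1) hall])
  then obtain f where f: "inj_on f V" "\<And>v. v \<in> V \<Longrightarrow> f v \<in> E `` {v}" by blast
  define g where "g v = (if v \<in> V then f v else v)" for v
  have "f ` V \<subseteq> V" using f(2) arc_V by blast
  then have "f ` V = V" using f(1) finite_V by (simp add: endo_inj_surj)
  then have "bij_betw f V V" using f(1) by (simp add: bij_betw_def)
  then have "bij_betw g V V" using bij_betw_cong[of V g f V] by (simp add: g_def)
  then have "g permutes V" by (rule bij_imp_permutes) (simp add: g_def)
  then show ?thesis using f(2) by (auto simp: cycle_factor_def g_def)
qed

end

section \<open>Factors that cannot be merged\<close>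

context balanced_bipartite
begin

text \<open>Being without partners propagates along arcs. Each neighbour of \<open>x\<close> on an
  arc leaving \<open>x\<close> has \<open>x\<close> as its only in-neighbour, hence degree at most
  \<open>a + 1\<close>; two of them would be partners with too small a sum. The same holds for arcs
  entering \<open>x\<close>. A partner \<open>y'\<close> of \<open>y\<close> would need degree at
  least \<open>2 * a - 1\<close>, but it is not adjacent to \<open>x\<close>.\<close>

lemma successor_of_partnerless_A:
  assumes a3: "3 \<le> a" and x: "x \<in> A" and alone: "\<And>y. \<not> partners E x y" and xy: "(x, y) \<in> E"
  shows "E `` {x} = {y}" and "\<And>y'. \<not> partners E y y'"
proof -
  have in_single: "E\<inverse> `` {w} = {x}" if "(x, w) \<in> E" for w
  proof -
    have "v = x" if "(v, w) \<in> E" for v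
      using alone[of v] that \<open>(x, w) \<in> E\<close> unfolding partners_def by blast
    then show ?thesis using that by blast
  qed
  have out_single: "E `` {w} = {x}" if "(w, x) \<in> E" for w
  proof -
    have "v = x" if "(w, v) \<in> E" for v
      using alone[of v] that \<open>(w, x) \<in> E\<close> unfolding partners_def by blast
    then show ?thesis using that by blast
  qed
  have out_deg: "deg E w \<le> a + 1" if "(x, w) \<in> E" for w
    using in_single[OF that] half_degree_le(1)[of w] arc_V(2)[OF that] by (simp add: deg_def)
  have in_deg: "deg E w \<le> a + 1" if "(w, x) \<in> E" for w
    using out_single[OF that] half_degree_le(2)[of w] arc_V(1)[OF that] by (simp add: deg_def)
  have "w = y" if "(x, w) \<in> E" for w
  proof (rule ccontr)
    assume "w \<noteq> y"
    then have "partners E w y" using that xy unfolding partners_def by blast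
    from partners_deg[OF this] out_deg[OF that] out_deg[OF xy] a3 show False by linarith
  qed
  then show out_x: "E `` {x} = {y}" using xy by blast
  obtain z where z: "(z, x) \<in> E" using ex_in_neighbour[of x] x by blast
  have in_x: "E\<inverse> `` {x} = {z}"
  proof -
    have "w = z" if "(w, x) \<in> E" for w
    proof (rule ccontr)
      assume "w \<noteq> z"
      then have "partners E w z" using that z unfolding partners_def by blast
      from partners_deg[OF this] in_deg[OF that] in_deg[OF z] a3 show False by linarith
    qed
    then show ?thesis using z by blast
  qed
  fix y' show "\<not> partners E y y'"
  proof
    assume y': "partners E y y'"
    have big: "2 * a \<le> deg E y' + 1" using partners_deg[OF y'] out_deg[OF xy] by linarith
    have "y' \<in> B" using y' xy x arc_A arc_B unfolding partners_def by blast
    have "y' \<noteq> z" using big in_deg[OF z] a3 by auto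
    then have "(y', x) \<notin> E" using in_x by blast
    moreover have "(x, y') \<notin> E" using out_x y' by (auto simp: partners_def)
    ultimately have "E `` {y'} \<subseteq> A - {x}" "E\<inverse> `` {y'} \<subseteq> A - {x}"
      using \<open>y' \<in> B\<close> arc_B by blast+
    then have "card (E `` {y'}) \<le> card (A - {x})" "card (E\<inverse> `` {y'}) \<le> card (A - {x})"
      using finite_A by (simp_all add: card_mono)
    then have "deg E y' \<le> 2 * (a - 1)" using x card_A by (simp add: deg_def)
    with big a3 show False by linarith
  qed
qed

lemma successor_of_partnerless:
  assumes "3 \<le> a" and x: "x \<in> V" and "\<And>y. \<not> partners E x y" and "(x, y) \<in> E"
  shows "E `` {x} = {y} \<and> (\<forall>y'. \<not> partners E y y')"
proof (cases "x \<in> A")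
  case True
  then show ?thesis using successor_of_partnerless_A[of x y] assms by simp
next
  case False
  interpret sw: balanced_bipartite B A E a by (rule swap)
  show ?thesis using sw.successor_of_partnerless_A[of x y] False assms by simp
qed

end

section \<open>A fixed unmergeable factor and the four cells it cuts out\<close>

locale unmerged = balanced_bipartite A B E a
  for A B :: "'a set" and E :: "('a \<times> 'a) set" and a :: nat +
  fixes f :: "'a \<Rightarrow> 'a" and C :: "'a set"
  assumes robust: "robustly_unmergeable (A \<union> B) E f C"
begin

text \<open>Together with \<open>complement\<close> this transfers every result about
  \<open>C \<inter> A\<close> to the other three cells.\<close>

lemma swap_unmerged: "unmerged B A E a f C"
  using robust by (intro unmerged.intro swap unmerged_axioms.intro) (simp add: Un_commute)

lemma complement: "unmerged A B E a f (V - C)"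
  using robustly_unmergeable_Diff[OF robust]
  by (intro unmerged.intro unmerged_axioms.intro balanced_bipartite_axioms)

lemma factor: "f permutes V" "\<And>v. v \<in> V \<Longrightarrow> (v, f v) \<in> E"
  and C_sub: "C \<subseteq> V" and C_ne: "C \<noteq> {}" and C_proper: "C \<noteq> V" and f_C: "f ` C = C"
  and no_merge: "\<And>p q. p \<in> C \<Longrightarrow> q \<in> V - C \<Longrightarrow> (p, f q) \<in> E \<Longrightarrow> (q, f p) \<in> E \<Longrightarrow> False"
  using robust unfolding robustly_unmergeable_def unmergeable_def cycle_factor_def by blast+

lemma f_in: "v \<in> C \<Longrightarrow> f v \<in> C"
  using f_C by blast

lemma f_A: "v \<in> A \<Longrightarrow> f v \<in> B" and f_B: "v \<in> B \<Longrightarrow> f v \<in> A"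
  using factor(2) arc_A arc_B by blast+

text \<open>Successors change part and stay in \<open>C\<close>; hence \<open>C\<close> is balanced,
  with \<open>s\<close> vertices in each part.\<close>

lemma f_bij: "bij_betw f (C \<inter> A) (C \<inter> B)"
proof -
  have "f ` (C \<inter> A) = C \<inter> B"
  proof (intro equalityI subsetI)
    fix w assume w: "w \<in> C \<inter> B"
    then obtain v where v: "v \<in> C" "w = f v" using f_C by blast
    then have "v \<in> A" using w C_sub f_B disjoint by blast
    then show "w \<in> f ` (C \<inter> A)" using v by blast
  qed (use f_in f_A in blast)
  then show ?thesis by (simp add: bij_betw_def permutes_inj_on[OF factor(1)])
qed

lemma Diff_Int_A: "(V - C) \<inter> A = A - C" and Diff_Int_B: "(V - C) \<inter> B = B - C"
  by auto

lemma f_bij_Diff: "bij_betw f (A - C) (B - C)"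
proof -
  interpret co: unmerged A B E a f "V - C" by (rule complement)
  show ?thesis using co.f_bij by (simp add: Diff_Int_A Diff_Int_B)
qed

abbreviation s where "s \<equiv> card (C \<inter> A)"

lemma card_C_B: "card (C \<inter> B) = s"
  using bij_betw_same_card[OF f_bij] by simp

lemma card_Diff_A: "card (A - C) = a - s"
  using finite_A card_A card_Diff_subset_Int[of A C] by (simp add: Int_commute)

lemma card_Diff_B: "card (B - C) = a - s"
  using bij_betw_same_card[OF f_bij_Diff] card_Diff_A by simp

lemma s_le: "s \<le> a"
  using finite_A card_A by (metis card_mono inf_le2)

lemma s_pos: "0 < s"
proof -
  obtain v where v: "v \<in> C" using C_ne by blast
  have "C \<inter> A \<noteq> {}"
  proof (cases "v \<in> A")
    case False
    then have "f v \<in> C \<inter> A" using v C_sub f_B f_in by blast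
    then show ?thesis by blast
  qed (use v in blast)
  then show ?thesis using finite_A by (simp add: card_gt_0_iff)
qed

lemma card_C: "card C = 2 * s"
proof -
  have "card C = card ((C \<inter> A) \<union> (C \<inter> B))"
    using C_sub by (intro arg_cong[where f = card]) blast
  also have "\<dots> = s + card (C \<inter> B)"
    using finite_A finite_B disjoint by (intro card_Un_disjoint) auto
  finally show ?thesis using card_C_B by simp
qed

text \<open>Since \<open>f\<close> maps \<open>A - C\<close> onto \<open>B - C\<close> and
  \<open>C \<inter> A\<close> onto \<open>C \<inter> B\<close>, every arc counted is
  \<open>p \<rightarrow> f q\<close> or \<open>q \<rightarrow> f p\<close> for a pair
  \<open>p \<in> C \<inter> A\<close>, \<open>q \<in> A - C\<close>. By \<open>no_merge\<close> each
  of the \<open>s * (a - s)\<close> pairs contributes at most one of the two.\<close>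

lemma cross_arcs_le:
  "num_arcs E (C \<inter> A) (B - C) + num_arcs E (A - C) (C \<inter> B) \<le> s * (a - s)"
proof -
  define S where "S = {(p, q) \<in> (C \<inter> A) \<times> (A - C). (p, f q) \<in> E}"
  define T where "T = {(p, q) \<in> (C \<inter> A) \<times> (A - C). (q, f p) \<in> E}"
  have fin: "finite S" "finite T"
    unfolding S_def T_def using finite_A by (auto intro: finite_subset[of _ "A \<times> A"])
  have "E \<inter> (C \<inter> A) \<times> (B - C) \<subseteq> (\<lambda>(p, q). (p, f q)) ` S"
  proof
    fix e assume "e \<in> E \<inter> (C \<inter> A) \<times> (B - C)"
    then obtain p w where e: "e = (p, w)" "(p, w) \<in> E" "p \<in> C \<inter> A" "w \<in> B - C" by blast
    then obtain q where "q \<in> A - C" "w = f q"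
      using f_bij_Diff by (auto simp: bij_betw_def)
    then show "e \<in> (\<lambda>(p, q). (p, f q)) ` S" using e by (auto simp: S_def)
  qed
  then have 1: "num_arcs E (C \<inter> A) (B - C) \<le> card S"
    unfolding num_arcs_def using fin(1) by (rule surj_card_le[rotated])
  have "E \<inter> (A - C) \<times> (C \<inter> B) \<subseteq> (\<lambda>(p, q). (q, f p)) ` T"
  proof
    fix e assume "e \<in> E \<inter> (A - C) \<times> (C \<inter> B)"
    then obtain q w where e: "e = (q, w)" "(q, w) \<in> E" "q \<in> A - C" "w \<in> C \<inter> B" by blast
    then obtain p where "p \<in> C \<inter> A" "w = f p"
      using f_bij by (auto simp: bij_betw_def)
    then show "e \<in> (\<lambda>(p, q). (q, f p)) ` T" using e by (auto simp: T_def)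
  qed
  then have 2: "num_arcs E (A - C) (C \<inter> B) \<le> card T"
    unfolding num_arcs_def using fin(2) by (rule surj_card_le[rotated])
  have "S \<inter> T = {}"
    unfolding S_def T_def using no_merge by auto
  then have "card S + card T = card (S \<union> T)" using fin by (simp add: card_Un_disjoint)
  also have "\<dots> \<le> card ((C \<inter> A) \<times> (A - C))"
    using finite_A by (intro card_mono) (auto simp: S_def T_def)
  also have "\<dots> = s * (a - s)" by (simp add: card_cartesian_product card_Diff_A)
  finally show ?thesis using 1 2 by linarith
qed

lemma sum_deg_C_A:
  "(\<Sum>v\<in>C \<inter> A. deg E v) = num_arcs E (C \<inter> A) (C \<inter> B) + num_arcs E (C \<inter> A) (B - C)
     + num_arcs E (C \<inter> B) (C \<inter> A) + num_arcs E (B - C) (C \<inter> A)"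
proof -
  have B: "B = (C \<inter> B) \<union> (B - C)" by blast
  have "num_arcs E (C \<inter> A) B = num_arcs E (C \<inter> A) (C \<inter> B) + num_arcs E (C \<inter> A) (B - C)"
    by (subst B, rule num_arcs_Un_right) (use finite_A finite_B in auto)
  moreover have "num_arcs E B (C \<inter> A) = num_arcs E (C \<inter> B) (C \<inter> A) + num_arcs E (B - C) (C \<inter> A)"
    by (subst B, rule num_arcs_Un_left) (use finite_A finite_B in auto)
  ultimately show ?thesis using sum_deg[of "C \<inter> A"] by simp
qed

text \<open>A partner has degree at most \<open>2 * a\<close>, which leaves at least
  \<open>a\<close> for \<open>v\<close>. If \<open>v\<close> had no partner, strong connectivity
  would spread this to all vertices, so every vertex \<open>u\<close> would have \<open>f u\<close>
  as its only out-neighbour and no arc could leave \<open>C\<close>.\<close>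

lemma min_degree:
  assumes a3: "3 \<le> a" and v: "v \<in> V"
  shows "a \<le> deg E v"
proof (cases "\<exists>y. partners E v y")
  case True
  then obtain y where y: "partners E v y" by blast
  then have "y \<in> V" using arc_V unfolding partners_def by blast
  with deg_le[of y] partners_deg[OF y] show ?thesis by linarith
next
  case False
  have all: "\<forall>y. \<not> partners E w y" if "w \<in> V" for w
  proof -
    have "(v, w) \<in> E\<^sup>*" using strong v that by blast
    then show ?thesis
    proof induction
      case (step y z)
      then show ?case using successor_of_partnerless[OF a3, of y z] arc_V by blast
    qed (use False in blast)
  qed
  obtain u w where uw: "u \<in> C" "w \<in> V - C" "(u, w) \<in> E"
    using exit_arc[OF C_sub C_ne C_proper] .
  then have "E `` {u} = {w}" using successor_of_partnerless[OF a3] all C_sub by blast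
  moreover have "f u \<in> E `` {u}" using factor(2) uw C_sub by blast
  ultimately have "f u = w" by blast
  then show ?thesis using f_in uw by blast
qed

section \<open>Complete bipartite digraphs on both sides\<close>

definition complete_parts :: bool where
  "complete_parts \<longleftrightarrow> (C \<inter> A) \<times> (C \<inter> B) \<subseteq> E \<and> (C \<inter> B) \<times> (C \<inter> A) \<subseteq> E \<and>
     (A - C) \<times> (B - C) \<subseteq> E \<and> (B - C) \<times> (A - C) \<subseteq> E"

text \<open>Inside complete parts, conjugating the factor by transpositions makes any two prescribed
  arcs \<open>p \<rightarrow> z\<close> and \<open>q \<rightarrow> v\<close> part of the factor; then \<open>p \<rightarrow> v\<close> and \<open>q \<rightarrow> z\<close> would merge.\<close>

lemma no_crossing_pair:
  assumes compl: complete_parts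
    and p: "p \<in> C \<inter> A" and v: "v \<in> B - C" and q: "q \<in> A - C" and z: "z \<in> C \<inter> B"
    and pv: "(p, v) \<in> E" and qz: "(q, z) \<in> E"
  shows False
proof -
  \<comment> \<open>The two transpositions act inside \<open>C \<inter> B\<close> and inside
    \<open>B - C\<close>, so \<open>\<tau>\<close> fixes \<open>A\<close> pointwise and preserves
    all four cells.\<close>
  define \<tau> where "\<tau> = transpose (f p) z \<circ> transpose (f q) v"
  have fp: "f p \<in> C \<inter> B" using p f_in f_A by blast
  have fq: "f q \<in> B - C" using q f_bij_Diff by (auto simp: bij_betw_def)
  have perm: "\<tau> permutes V"
    unfolding \<tau>_def using fp fq z v by (intro permutes_compose permutes_swap_id) auto
  have cells: "\<tau> w \<in> C \<inter> B" if "w \<in> C \<inter> B" for w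
    using that fp fq z v by (auto simp: \<tau>_def transpose_def)
  have cells': "\<tau> w \<in> B - C" if "w \<in> B - C" for w
    using that fp fq z v by (auto simp: \<tau>_def transpose_def)
  have fix_A: "\<tau> w = w" if "w \<in> A" for w
  proof -
    have "w \<noteq> f p" "w \<noteq> z" "w \<noteq> f q" "w \<noteq> v" using that fp fq z v disjoint by auto
    then show ?thesis by (simp add: \<tau>_def)
  qed
  \<comment> \<open>Each image pair lies on one side of \<open>C\<close> and in different parts, so
    completeness supplies the arc.\<close>
  have arc: "(\<tau> w, \<tau> (f w)) \<in> E" if w: "w \<in> V" for w
  proof -
    consider "w \<in> C \<inter> A" | "w \<in> C \<inter> B" | "w \<in> A - C" | "w \<in> B - C" using w by blast
    then show ?thesis
    proof cases
      case 1
      then have "f w \<in> C \<inter> B" using f_in f_A by blast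
      then show ?thesis using cells fix_A[of w] 1 compl unfolding complete_parts_def by auto
    next
      case 2
      then have "f w \<in> C \<inter> A" using f_in f_B by blast
      then show ?thesis using cells fix_A[of "f w"] 2 compl unfolding complete_parts_def by auto
    next
      case 3
      then have "f w \<in> B - C" using f_bij_Diff by (auto simp: bij_betw_def)
      then show ?thesis using cells' fix_A[of w] 3 compl unfolding complete_parts_def by auto
    next
      case 4
      then have "f w \<in> A - C"
        using unmerged.f_bij_Diff[OF swap_unmerged] by (auto simp: bij_betw_def)
      then show ?thesis using cells' fix_A[of "f w"] 4 compl unfolding complete_parts_def by auto
    qed
  qed
  have "\<tau> ` C = C"
  proof (rule card_subset_eq)
    show "finite C" using C_sub finite_V finite_subset by blast
    show "\<tau> ` C \<subseteq> C" using cells fix_A C_sub by fastforce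
    show "card (\<tau> ` C) = card C" by (rule card_image, rule permutes_inj_on[OF perm])
  qed
  moreover have "cycle_factor V E (\<tau> \<circ> f \<circ> inv \<tau>)"
    unfolding cycle_factor_def
  proof (intro conjI ballI)
    show "(\<tau> \<circ> f \<circ> inv \<tau>) permutes V"
      using perm factor(1) by (intro permutes_compose permutes_inv)
    fix w assume "w \<in> V"
    then have "inv \<tau> w \<in> V" using permutes_in_image[OF permutes_inv[OF perm]] by blast
    then show "(w, (\<tau> \<circ> f \<circ> inv \<tau>) w) \<in> E"
      using arc[of "inv \<tau> w"] permutes_inverses(1)[OF perm, of w] by simp
  qed
  ultimately have unm: "unmergeable V E (\<tau> \<circ> f \<circ> inv \<tau>) C"
    using robust perm unfolding robustly_unmergeable_def by blast
  have "inv \<tau> p = p" "inv \<tau> q = q"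
    using fix_A p q perm by (auto simp: permutes_inv_eq)
  moreover have "\<tau> (f p) = z" "\<tau> (f q) = v"
    using fp fq z v by (auto simp: \<tau>_def transpose_def)
  ultimately have "(p, (\<tau> \<circ> f \<circ> inv \<tau>) q) \<in> E" "(q, (\<tau> \<circ> f \<circ> inv \<tau>) p) \<in> E"
    using pv qz by simp_all
  then show False using unm p q unfolding unmergeable_def by blast
qed

lemma complete_parts_swap: "complete_parts \<Longrightarrow> unmerged.complete_parts B A E C"
  unfolding complete_parts_def unmerged.complete_parts_def[OF swap_unmerged] by blast

text \<open>The arc from \<open>u\<close> to \<open>w\<close> rules out all arcs from
  \<open>A - C\<close> to \<open>C \<inter> B\<close>. An arc returning to \<open>C\<close> must
  therefore go from \<open>B - C\<close> to \<open>C \<inter> A\<close>, and with the parts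
  exchanged it rules out all arcs from \<open>C \<inter> B\<close> to \<open>A - C\<close>.\<close>

lemma exit_from_A:
  assumes compl: complete_parts
    and u: "u \<in> C \<inter> A" and w: "w \<in> B - C" and uw: "(u, w) \<in> E"
  shows "\<And>q z. q \<in> A - C \<Longrightarrow> z \<in> C \<inter> B \<Longrightarrow> (q, z) \<notin> E \<and> (z, q) \<notin> E"
    and "\<exists>u'\<in>B - C. \<exists>w'\<in>C \<inter> A. (u', w') \<in> E"
proof -
  interpret sw: unmerged B A E a f C by (rule swap_unmerged)
  have no_in: "(q, z) \<notin> E" if "q \<in> A - C" "z \<in> C \<inter> B" for q z
    using no_crossing_pair[OF compl u w that uw] by blast
  have "V - C \<subseteq> V" "V - C \<noteq> {}" "V - C \<noteq> V" using C_sub C_ne C_proper by auto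
  then obtain u' w' where "u' \<in> V - C" "w' \<in> V - (V - C)" "(u', w') \<in> E"
    by (rule exit_arc)
  then have uw': "u' \<in> B - C" "w' \<in> C \<inter> A" "(u', w') \<in> E"
    using no_in arc_A arc_B by blast+
  then show "\<exists>u'\<in>B - C. \<exists>w'\<in>C \<inter> A. (u', w') \<in> E" by blast
  fix q z assume qz: "q \<in> A - C" "z \<in> C \<inter> B"
  show "(q, z) \<notin> E \<and> (z, q) \<notin> E"
    using no_in[OF qz]
      sw.no_crossing_pair[OF complete_parts_swap[OF compl] qz(2,1) uw'(1,2) _ uw'(3)] by blast
qed

text \<open>Without arcs between \<open>A - C\<close> and \<open>C \<inter> B\<close>, their
  vertices have degree at most \<open>2 * (a - s)\<close> and \<open>2 * s\<close> respectively. The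
  minimum degree \<open>a\<close> forces \<open>a = 2 * s\<close>, and then two vertices of
  \<open>C \<inter> B\<close>, partners through \<open>u\<close>, have degree sum at most
  \<open>2 * a\<close>.\<close>

lemma incomplete_if_exit_from_A:
  assumes a3: "3 \<le> a" and compl: complete_parts
    and u: "u \<in> C \<inter> A" and w: "w \<in> B - C" and uw: "(u, w) \<in> E"
  shows False
proof -
  interpret sw: unmerged B A E a f C by (rule swap_unmerged)
  note no_arc = exit_from_A(1)[OF compl u w uw]
  have deg_C: "deg E z \<le> 2 * s" if z: "z \<in> C \<inter> B" for z
  proof -
    have "E `` {z} \<subseteq> C \<inter> A" "E\<inverse> `` {z} \<subseteq> C \<inter> A"
      using z arc_B no_arc by blast+
    then have "card (E `` {z}) \<le> s" "card (E\<inverse> `` {z}) \<le> s"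
      using finite_A by (auto intro!: card_mono)
    then show ?thesis by (simp add: deg_def)
  qed
  have deg_D: "deg E q \<le> 2 * (a - s)" if q: "q \<in> A - C" for q
  proof -
    have "E `` {q} \<subseteq> B - C" "E\<inverse> `` {q} \<subseteq> B - C"
      using q arc_A no_arc by blast+
    then have "card (E `` {q}) \<le> a - s" "card (E\<inverse> `` {q}) \<le> a - s"
      unfolding card_Diff_B[symmetric] using finite_B by (auto intro!: card_mono)
    then show ?thesis by (simp add: deg_def)
  qed
  have fu: "f u \<in> C \<inter> B" using u f_in f_A by blast
  have ge: "a \<le> 2 * s" using deg_C[OF fu] min_degree[OF a3, of "f u"] fu by simp
  have "f w \<in> A - C" using w sw.f_bij_Diff by (auto simp: bij_betw_def)
  then have "a \<le> 2 * (a - s)" using deg_D[of "f w"] min_degree[OF a3, of "f w"] by simp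
  then have eq: "a = 2 * s" using ge s_le by linarith
  then have "2 \<le> card (C \<inter> B)" using a3 card_C_B by linarith
  then have "\<not> C \<inter> B \<subseteq> {f u}" using card_mono[of "{f u}" "C \<inter> B"] by auto
  then obtain y where y: "y \<in> C \<inter> B" "y \<noteq> f u" by blast
  have "(u, y) \<in> E" "(u, f u) \<in> E"
    using y(1) fu u compl unfolding complete_parts_def by blast+
  then have "partners E y (f u)" using y(2) unfolding partners_def by blast
  from partners_deg[OF this] show False using deg_C[OF y(1)] deg_C[OF fu] eq a3 by linarith
qed

lemma incomplete:
  assumes "3 \<le> a"
  shows "\<not> complete_parts"
proof
  assume compl: complete_parts
  obtain u w where uw: "u \<in> C" "w \<in> V - C" "(u, w) \<in> E"
    using exit_arc[OF C_sub C_ne C_proper] .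
  show False
  proof (cases "u \<in> A")
    case True
    then show False using incomplete_if_exit_from_A[OF assms compl, of u w] uw arc_A by blast
  next
    case False
    then show False
      using unmerged.incomplete_if_exit_from_A[OF swap_unmerged assms complete_parts_swap[OF compl], of u w]
        uw arc_B C_sub by blast
  qed
qed

end

section \<open>Degree counting\<close>

locale unmerged_ge_3 = unmerged A B E a f C
  for A B :: "'a set" and E :: "('a \<times> 'a) set" and a :: nat and f C +
  assumes a_ge_3: "3 \<le> a"
begin

lemma swap_ge_3: "unmerged_ge_3 B A E a f C"
  using a_ge_3 by (intro unmerged_ge_3.intro swap_unmerged unmerged_ge_3_axioms.intro)

text \<open>The threshold is half of the bound \<open>3 * a\<close>, so two low vertices are never
  partners.\<close>

definition low :: "'a \<Rightarrow> bool" where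
  "low v \<longleftrightarrow> 2 * deg E v < 3 * a"

lemma deg_ge: "v \<in> V \<Longrightarrow> a \<le> deg E v"
  using min_degree[OF a_ge_3] .

lemma non_partners_disjoint:
  assumes "x \<noteq> v" "\<not> partners E x v"
  shows "E `` {x} \<inter> E `` {v} = {}" "E\<inverse> `` {x} \<inter> E\<inverse> `` {v} = {}"
  using assms unfolding partners_def by blast+

text \<open>The neighbourhoods are disjoint subsets of \<open>B\<close>. Equality in the second
  bound later makes the out-neighbourhoods cover \<open>B\<close>.\<close>

lemma non_partners_half_degrees:
  assumes "x \<in> A" "v \<in> A" "x \<noteq> v" "\<not> partners E x v"
  shows "card (E `` {x} \<union> E `` {v}) = card (E `` {x}) + card (E `` {v})"
    and "card (E `` {x}) + card (E `` {v}) \<le> a"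
    and "card (E\<inverse> `` {x}) + card (E\<inverse> `` {v}) \<le> a"
proof -
  show eq: "card (E `` {x} \<union> E `` {v}) = card (E `` {x}) + card (E `` {v})"
    using finite_neighbours non_partners_disjoint[OF assms(3,4)] by (simp add: card_Un_disjoint)
  show "card (E `` {x}) + card (E `` {v}) \<le> a"
    unfolding eq[symmetric] card_B[symmetric]
    using neighbours_A assms finite_B by (intro card_mono) auto
  have "card (E\<inverse> `` {x} \<union> E\<inverse> `` {v}) = card (E\<inverse> `` {x}) + card (E\<inverse> `` {v})"
    using finite_neighbours non_partners_disjoint[OF assms(3,4)] by (simp add: card_Un_disjoint)
  moreover have "card (E\<inverse> `` {x} \<union> E\<inverse> `` {v}) \<le> a"
    unfolding card_B[symmetric] using neighbours_A assms finite_B by (intro card_mono) auto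
  ultimately show "card (E\<inverse> `` {x}) + card (E\<inverse> `` {v}) \<le> a" by simp
qed

lemma non_partners_deg:
  assumes "x \<in> A" "v \<in> A" "x \<noteq> v" "\<not> partners E x v"
  shows "deg E x + deg E v \<le> 2 * a"
  using non_partners_half_degrees(2,3)[OF assms] by (simp add: deg_def)

text \<open>They must be partners: non-partners have degree sum at most \<open>2 * a\<close>, but
  here the sum is at least \<open>a\<close> plus \<open>3a/2\<close>.\<close>

lemma low_high_deg:
  assumes "x \<in> A" "v \<in> A" "low x" "\<not> low v"
  shows "3 * a \<le> deg E x + deg E v"
proof -
  have "x \<noteq> v" using assms by blast
  moreover have "a \<le> deg E x" using assms deg_ge by blast
  ultimately have "partners E x v"
    using non_partners_deg[of x v] assms a_ge_3 unfolding low_def by fastforce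
  then show ?thesis by (rule partners_deg)
qed

lemma two_low:
  assumes "x \<in> A" "y \<in> A" "x \<noteq> y" "low x" "low y"
  shows "\<not> partners E x y" "deg E x = a" "deg E y = a"
proof -
  show *: "\<not> partners E x y"
    using partners_deg[of x y] assms unfolding low_def by linarith
  show "deg E x = a" "deg E y = a"
    using non_partners_deg[OF assms(1-3) *] deg_ge[of x] deg_ge[of y] assms by auto
qed

text \<open>If \<open>v\<close> is not low, it is a partner of \<open>x\<close>, whose degree is
  exactly \<open>a\<close>. If \<open>v\<close> were low too, it would share an out-neighbour with
  \<open>x\<close> or \<open>y\<close>, because the out-neighbourhoods of these two partition
  \<open>B\<close>.\<close>

lemma high_of_two_low:
  assumes xy: "x \<in> A" "y \<in> A" "x \<noteq> y" "low x" "low y" and v: "v \<in> A" "v \<noteq> x" "v \<noteq> y"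
  shows "2 * a \<le> deg E v"
proof (cases "low v")
  case False
  then show ?thesis using low_high_deg[OF xy(1) v(1) xy(4)] two_low(2)[OF xy] by simp
next
  case True
  note np = two_low(1)[OF xy]
  have "card (E `` {x}) + card (E `` {y}) = a"
    using non_partners_half_degrees(2,3)[OF xy(1-3) np] two_low(2,3)[OF xy]
    unfolding deg_def by linarith
  then have "card (E `` {x} \<union> E `` {y}) = card B"
    using non_partners_half_degrees(1)[OF xy(1-3) np] card_B by simp
  then have cover: "E `` {x} \<union> E `` {y} = B"
    using finite_B neighbours_A xy by (intro card_subset_eq) auto
  obtain w where w: "(v, w) \<in> E" using ex_out_neighbour[of v] v by blast
  then have "w \<in> E `` {x} \<union> E `` {y}" using cover arc_A v by blast
  then have "partners E x v \<or> partners E y v" using w v unfolding partners_def by blast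
  then show ?thesis
    using two_low(1)[OF xy(1) v(1) _ xy(4) True] two_low(1)[OF xy(2) v(1) _ xy(5) True] v by blast
qed

lemma full_degree:
  assumes "v \<in> A" "2 * a \<le> deg E v" "w \<in> B"
  shows "(v, w) \<in> E" "(w, v) \<in> E"
proof -
  have "card (E `` {v}) = card B" "card (E\<inverse> `` {v}) = card B"
    using assms half_degree_le[of v] card_B by (auto simp: deg_def)
  then have "E `` {v} = B" "E\<inverse> `` {v} = B"
    using neighbours_A[OF assms(1)] finite_B by (simp_all add: card_subset_eq)
  then show "(v, w) \<in> E" "(w, v) \<in> E" using assms(3) by blast+
qed

text \<open>A single low vertex of degree \<open>d\<close> is balanced by any other vertex, of
  degree at least \<open>e = 3 * a - d\<close>; the remaining ones exceed the average
  \<open>3a/2\<close>.\<close>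

lemma sum_deg_ge:
  assumes X: "X \<subseteq> A" "2 \<le> card X" and one: "\<And>x y. x \<in> X \<Longrightarrow> y \<in> X \<Longrightarrow> low x \<Longrightarrow> low y \<Longrightarrow> x = y"
  shows "3 * a * card X \<le> 2 * (\<Sum>v\<in>X. deg E v)"
proof (cases "\<exists>x\<in>X. low x")
  case False
  then have "card X * (3 * a) \<le> (\<Sum>v\<in>X. 2 * deg E v)"
    using sum_bounded_below[of X "3 * a" "\<lambda>v. 2 * deg E v"] by (simp add: low_def not_less)
  then show ?thesis by (simp add: sum_distrib_left mult.commute)
next
  case True
  then obtain x where x: "x \<in> X" "low x" by blast
  obtain m where m: "card X = m + 2" using X(2) by (metis add.commute le_Suc_ex)
  define d where "d = deg E x"
  have "d < 3 * a - d" using x(2) unfolding low_def d_def by linarith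
  then obtain e where e: "3 * a = d + e" "d < e"
    by (intro that[of "3 * a - d"]) linarith+
  have finX: "finite X" using X finite_A finite_subset by blast
  have "e \<le> deg E v" if "v \<in> X - {x}" for v
  proof -
    have "\<not> low v" using that one x by blast
    then show ?thesis using low_high_deg[of x v] that x X e unfolding d_def by auto
  qed
  then have "card (X - {x}) * e \<le> (\<Sum>v\<in>X - {x}. deg E v)"
    using sum_bounded_below[of "X - {x}" e "deg E"] by simp
  moreover have "card (X - {x}) = m + 1" using x m finX by simp
  moreover have "(\<Sum>v\<in>X. deg E v) = d + (\<Sum>v\<in>X - {x}. deg E v)"
    using x finX unfolding d_def by (simp add: sum.remove)
  ultimately have "d + (m + 1) * e \<le> (\<Sum>v\<in>X. deg E v)" by simp
  moreover have "3 * a * card X \<le> 2 * (d + (m + 1) * e)"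
  proof -
    have "m * d \<le> m * e" using e by simp
    then show ?thesis unfolding e(1) m by (simp add: algebra_simps)
  qed
  ultimately show ?thesis by (meson le_trans mult_le_mono2)
qed

text \<open>All of \<open>A - C\<close> is then joined to everything in both directions, so
  \<open>no_merge\<close> forbids every arc between \<open>C \<inter> A\<close> and
  \<open>B - C\<close>. The two low vertices, of degree \<open>a\<close>, can only reach it by being
  joined to all of \<open>C \<inter> B\<close>, which makes them partners.\<close>

lemma not_two_low_in_C:
  assumes half: "2 * s \<le> a" and xy: "x \<in> C \<inter> A" "y \<in> C \<inter> A" "x \<noteq> y" "low x" "low y"
  shows False
proof -
  have full: "(v, w) \<in> E" "(w, v) \<in> E" if "v \<in> A - C" "w \<in> B" for v w
  proof -
    have "2 * a \<le> deg E v" using high_of_two_low[of x y v] xy that by blast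
    then show "(v, w) \<in> E" "(w, v) \<in> E" using full_degree that by blast+
  qed
  have out: "E `` {p} \<subseteq> C \<inter> B" if p: "p \<in> C \<inter> A" for p
  proof
    fix v assume "v \<in> E `` {p}"
    then have v: "(p, v) \<in> E" "v \<in> B" using p arc_A by blast+
    show "v \<in> C \<inter> B"
    proof (rule ccontr)
      assume "v \<notin> C \<inter> B"
      then obtain q where q: "q \<in> A - C" "v = f q"
        using v f_bij_Diff by (auto simp: bij_betw_def)
      have "(q, f p) \<in> E" using full(1)[OF q(1)] f_A p by blast
      then show False using no_merge[of p q] p q v by blast
    qed
  qed
  have "in": "E\<inverse> `` {r} \<subseteq> C \<inter> B" if r: "r \<in> C \<inter> A" for r
  proof
    fix q assume "q \<in> E\<inverse> `` {r}"
    then have q: "(q, r) \<in> E" "q \<in> B" using r arc_A by blast+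
    show "q \<in> C \<inter> B"
    proof (rule ccontr)
      assume "q \<notin> C \<inter> B"
      then have q': "q \<in> B - C" using q by blast
      obtain p where p: "p \<in> C \<inter> B" "r = f p"
        using r unmerged.f_bij[OF swap_unmerged] by (auto simp: bij_betw_def)
      have "f q \<in> A - C"
        using q' unmerged.f_bij_Diff[OF swap_unmerged] by (auto simp: bij_betw_def)
      then have "(p, f q) \<in> E" using full(2) p by blast
      then show False using no_merge[of p q] p q q' by blast
    qed
  qed
  \<comment> \<open>Both half-degrees are at most \<open>s\<close>, and they add up to
    \<open>a \<ge> 2 * s\<close>, so both bounds are attained.\<close>
  have all: "E `` {p} = C \<inter> B" if p: "p \<in> C \<inter> A" "deg E p = a" for p
  proof (rule card_subset_eq)
    have "card (E `` {p}) \<le> s" "card (E\<inverse> `` {p}) \<le> s"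
      unfolding card_C_B[symmetric] using out[OF p(1)] "in"[OF p(1)] finite_B
      by (auto intro!: card_mono)
    then show "card (E `` {p}) = card (C \<inter> B)"
      using p(2) half unfolding deg_def card_C_B by linarith
  qed (use out p finite_B in auto)
  have xyA: "x \<in> A" "y \<in> A" using xy by auto
  have "E `` {x} = C \<inter> B" "E `` {y} = C \<inter> B"
    using all xy two_low(2,3)[OF xyA xy(3-5)] by blast+
  then have "C \<inter> B = {}"
    using non_partners_disjoint(1)[OF xy(3) two_low(1)[OF xyA xy(3-5)]] by blast
  then show False using card_C_B s_pos by simp
qed

section \<open>Arc counts against degree sums\<close>

lemma num_arcs_cells_le:
  "num_arcs E (C \<inter> A) (C \<inter> B) \<le> s * s" "num_arcs E (C \<inter> B) (C \<inter> A) \<le> s * s"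
  "num_arcs E (A - C) (B - C) \<le> (a - s) * (a - s)" "num_arcs E (B - C) (A - C) \<le> (a - s) * (a - s)"
  using num_arcs_le[of "C \<inter> A" "C \<inter> B" E] num_arcs_le[of "C \<inter> B" "C \<inter> A" E]
    num_arcs_le[of "A - C" "B - C" E] num_arcs_le[of "B - C" "A - C" E]
    finite_A finite_B card_C_B card_Diff_A card_Diff_B by simp_all

lemma cross_arcs_le_B:
  "num_arcs E (C \<inter> B) (A - C) + num_arcs E (B - C) (C \<inter> A) \<le> s * (a - s)"
  using unmerged.cross_arcs_le[OF swap_unmerged] by (simp add: card_C_B)

lemma sum_deg_Diff_A:
  "(\<Sum>v\<in>A - C. deg E v) = num_arcs E (A - C) (B - C) + num_arcs E (A - C) (C \<inter> B)
     + num_arcs E (B - C) (A - C) + num_arcs E (C \<inter> B) (A - C)"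
proof -
  have "A - (V - C) = C \<inter> A" "B - (V - C) = C \<inter> B" by auto
  then show ?thesis
    using unmerged.sum_deg_C_A[OF complement] by (simp only: Diff_Int_A Diff_Int_B)
qed

lemma complete_if_many_arcs:
  assumes "s * s \<le> num_arcs E (C \<inter> A) (C \<inter> B)" "s * s \<le> num_arcs E (C \<inter> B) (C \<inter> A)"
    "(a - s) * (a - s) \<le> num_arcs E (A - C) (B - C)" "(a - s) * (a - s) \<le> num_arcs E (B - C) (A - C)"
  shows complete_parts
  unfolding complete_parts_def
  using assms finite_A finite_B card_C_B card_Diff_A card_Diff_B
  by (intro conjI num_arcs_complete) simp_all

text \<open>Here the upper bound from the arc counts meets the lower bound from the degrees, so all
  four cells are saturated, against \<open>incomplete\<close>.\<close>

lemma not_exactly_half: "2 * s \<noteq> a"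
proof
  assume half: "2 * s = a"
  have "s \<ge> 2" using half a_ge_3 by linarith
  have lower: "3 * a * a \<le> 2 * (\<Sum>v\<in>A. deg E v)"
  proof (cases "\<exists>x\<in>A. \<exists>y\<in>A. x \<noteq> y \<and> low x \<and> low y")
    case False
    then show ?thesis using sum_deg_ge[of A] card_A a_ge_2 by auto
  next
    case True
    then obtain x y where xy: "x \<in> A" "y \<in> A" "x \<noteq> y" "low x" "low y" by blast
    have "card (A - {x, y}) * (2 * a) \<le> (\<Sum>v\<in>A - {x, y}. deg E v)"
      using sum_bounded_below[of "A - {x, y}" "2 * a" "deg E"] high_of_two_low[OF xy] by simp
    moreover have "card (A - {x, y}) = a - 2"
      using xy card_A finite_A by (simp add: card_Diff_subset)
    moreover have "(\<Sum>v\<in>A. deg E v) = (\<Sum>v\<in>A - {x, y}. deg E v) + (\<Sum>v\<in>{x, y}. deg E v)"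
      using xy finite_A by (intro sum.subset_diff) auto
    moreover have "(\<Sum>v\<in>{x, y}. deg E v) = 2 * a" using xy two_low(2,3)[OF xy] by simp
    ultimately have "(a - 2) * (2 * a) + 2 * a \<le> (\<Sum>v\<in>A. deg E v)" by simp
    \<comment> \<open>This needs \<open>a \<ge> 4\<close>, which holds because \<open>a\<close> is
      even and at least 3.\<close>
    moreover have "3 * a * a \<le> 2 * ((a - 2) * (2 * a) + 2 * a)"
    proof -
      obtain k where "s = k + 2" using \<open>s \<ge> 2\<close> by (metis add.commute le_Suc_ex)
      then have "a = 2 * k + 4" using half by simp
      then show ?thesis by (simp add: algebra_simps)
    qed
    ultimately show ?thesis by (meson le_trans mult_le_mono2)
  qed
  have split: "(\<Sum>v\<in>A. deg E v) = (\<Sum>v\<in>A - C. deg E v) + (\<Sum>v\<in>C \<inter> A. deg E v)"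
    using sum.subset_diff[of "C \<inter> A" A "deg E"] finite_A by (simp add: Diff_Int)
  \<comment> \<open>Naming the product makes all bounds linear: four cells of at most
    \<open>t\<close> arcs each and \<open>2 * t\<close> cross arcs total \<open>6 * t\<close>, which
    is also the lower bound.\<close>
  define t where "t = s * s"
  have "a - s = s" using half by linarith
  then have sub: "(a - s) * (a - s) = t" "s * (a - s) = t" by (simp_all add: t_def)
  have "3 * a * a = 12 * t" unfolding t_def half[symmetric] by simp
  then have "6 * t \<le> (\<Sum>v\<in>A - C. deg E v) + (\<Sum>v\<in>C \<inter> A. deg E v)"
    using lower split by simp
  note bounds = this[unfolded sum_deg_Diff_A sum_deg_C_A]
    num_arcs_cells_le[unfolded sub t_def[symmetric]]
    cross_arcs_le[unfolded sub] cross_arcs_le_B[unfolded sub]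
  have complete_parts
  proof (rule complete_if_many_arcs, unfold sub t_def[symmetric])
    show "t \<le> num_arcs E (C \<inter> A) (C \<inter> B)" using bounds by linarith
    show "t \<le> num_arcs E (C \<inter> B) (C \<inter> A)" using bounds by linarith
    show "t \<le> num_arcs E (A - C) (B - C)" using bounds by linarith
    show "t \<le> num_arcs E (B - C) (A - C)" using bounds by linarith
  qed
  then show False using incomplete[OF a_ge_3] by blast
qed

text \<open>\<open>C\<close> is a single 2-cycle and \<open>x\<close> is low. With a second low
  vertex, \<open>x\<close> turns out to have no neighbour besides \<open>y\<close>. Without one, the
  degrees in \<open>A - C\<close> are so large that all four cells are saturated.\<close>

lemma not_two_cycle:
  assumes one: "s = 1" and x: "x \<in> C \<inter> A" and d: "deg E x \<le> a + 1"
  shows False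
proof -
  have CA: "C \<inter> A = {x}" using one x by (metis card_1_singletonE singletonD)
  define y where "y = f x"
  have y: "y \<in> C \<inter> B" using x f_in f_A unfolding y_def by blast
  then have CB: "C \<inter> B = {y}" using one card_C_B by (metis card_1_singletonE singletonD)
  have fy: "f y = x" using y f_in f_B CA by blast
  have lowx: "low x" using d a_ge_3 unfolding low_def by linarith
  show False
  proof (cases "\<exists>z\<in>A - {x}. low z")
    case True
    then obtain z where z: "z \<in> A" "x \<noteq> z" "low z" by blast
    have xA: "x \<in> A" using x by blast
    note np = two_low(1)[OF xA z(1,2) lowx z(3)]
    \<comment> \<open>All vertices of \<open>A\<close> other than \<open>x\<close> and
      \<open>z\<close> have degree \<open>2 * a\<close>, so only \<open>z\<close> can lack an
      arc.\<close>
    have full: "v = z" if "v \<in> A - C" "(v, w) \<notin> E \<or> (w, v) \<notin> E" "w \<in> B" for v w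
      using full_degree[of v w] high_of_two_low[OF xA z(1,2) lowx z(3), of v] that x by blast
    have "E `` {x} \<subseteq> {y}"
    proof
      fix v assume "v \<in> E `` {x}"
      then have v: "(x, v) \<in> E" "v \<in> B" using xA arc_A by blast+
      show "v \<in> {y}"
      proof (rule ccontr)
        assume "v \<notin> {y}"
        then obtain q where q: "q \<in> A - C" "v = f q"
          using v CB f_bij_Diff by (auto simp: bij_betw_def)
        then have "(q, y) \<notin> E" using no_merge[of x q] x v y_def by blast
        then have "q = z" using full q y by blast
        then have "(z, v) \<in> E" using q factor(2) by blast
        then show False using np v z unfolding partners_def by blast
      qed
    qed
    then have 1: "card (E `` {x}) \<le> 1" using card_mono[of "{y}"] by fastforce
    have "E\<inverse> `` {x} \<subseteq> {y}"
    proof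
      fix v assume "v \<in> E\<inverse> `` {x}"
      then have v: "(v, x) \<in> E" "v \<in> B" using xA arc_A by blast+
      show "v \<in> {y}"
      proof (rule ccontr)
        assume "v \<notin> {y}"
        then have vD: "v \<in> B - C" using v CB by blast
        then have fv: "f v \<in> A - C"
          using unmerged.f_bij_Diff[OF swap_unmerged] by (auto simp: bij_betw_def)
        have "(y, f v) \<notin> E" using no_merge[of y v] y vD v fy by blast
        then have "f v = z" using full fv y by blast
        then have "(v, z) \<in> E" using v factor(2) by blast
        then show False using np v z unfolding partners_def by blast
      qed
    qed
    then have "card (E\<inverse> `` {x}) \<le> 1" using card_mono[of "{y}"] by fastforce
    then show False using 1 deg_ge[of x] xA a_ge_3 unfolding deg_def by simp
  next
    case False
    define b where "b = a - 1"
    have b: "a = b + 1" "2 \<le> b" using a_ge_3 unfolding b_def by linarith+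
    \<comment> \<open>The amount by which \<open>deg E x\<close> falls short of
      \<open>a + 1\<close>. The lower bound for each of the \<open>b\<close> other vertices of
      \<open>A\<close> rises by the same amount, so one of them already makes up for the
      loss.\<close>
    define k where "k = b + 2 - deg E x"
    have k: "b + 2 = deg E x + k" using d b unfolding k_def by linarith
    have "2 * b + 1 + k \<le> deg E v" if v: "v \<in> A - C" for v
    proof -
      have "\<not> low v" using False v x by blast
      then have "3 * a \<le> deg E x + deg E v" using low_high_deg[of x v] x v lowx by blast
      then show ?thesis using k b by linarith
    qed
    then have "card (A - C) * (2 * b + 1 + k) \<le> (\<Sum>v\<in>A - C. deg E v)"
      using sum_bounded_below[of "A - C" "2 * b + 1 + k" "deg E"] by simp
    then have 1: "b * (2 * b + 1 + k) \<le> (\<Sum>v\<in>A - C. deg E v)"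
      using card_Diff_A one b by simp
    have "deg E x = (\<Sum>v\<in>C \<inter> A. deg E v)" using CA by simp
    then have 2: "b + 2 = (\<Sum>v\<in>C \<inter> A. deg E v) + k" using k by simp
    define t where "t = b * b"
    have "k \<le> b * k" using b by simp
    moreover have "2 * t + b + b * k \<le> (\<Sum>v\<in>A - C. deg E v)"
      using 1 unfolding t_def by (simp add: algebra_simps)
    ultimately have 3: "2 * t + b + k \<le> (\<Sum>v\<in>A - C. deg E v)" by linarith
    have "a - s = b" using b one by simp
    then have sub: "(a - s) * (a - s) = t" "s * (a - s) = b" "s * s = 1"
      using one by (simp_all add: t_def)
    have xy: "(x, y) \<in> E" "(y, x) \<in> E" using factor(2)[of x] factor(2)[of y] x y y_def fy by auto
    then have "E \<inter> {x} \<times> {y} = {(x, y)}" "E \<inter> {y} \<times> {x} = {(y, x)}" by auto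
    then have 4: "num_arcs E (C \<inter> A) (C \<inter> B) = 1" "num_arcs E (C \<inter> B) (C \<inter> A) = 1"
      unfolding num_arcs_def CA CB by simp_all
    note bounds = 2[unfolded sum_deg_C_A] 3[unfolded sum_deg_Diff_A] 4
      num_arcs_cells_le[unfolded sub] cross_arcs_le[unfolded sub] cross_arcs_le_B[unfolded sub]
    have complete_parts
      by (rule complete_if_many_arcs; unfold sub; use bounds in linarith)
    then show False using incomplete[OF a_ge_3] by blast
  qed
qed

text \<open>The assumption \<open>few\<close> says that the average degree in
  \<open>C \<inter> A\<close> is at most \<open>a + s\<close>, below \<open>3a/2\<close>. For
  \<open>2 \<le> s\<close> this forces two low vertices there; \<open>s = 1\<close> is the case of a
  2-cycle.\<close>

lemma not_small_with_few_arcs: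
  assumes half: "2 * s < a" and few: "2 * (\<Sum>v\<in>C \<inter> A. deg E v) \<le> 4 * (s * s) + 2 * (s * (a - s))"
  shows False
proof (cases "s = 1")
  case True
  then obtain x where "C \<inter> A = {x}" by (auto simp: card_1_singleton_iff)
  moreover from this few True a_ge_3 have "deg E x \<le> a + 1" by simp
  ultimately show False using not_two_cycle[OF True, of x] by blast
next
  case False
  then have "2 \<le> s" using s_pos by linarith
  obtain t where t: "a = 2 * s + t" "0 < t" using half by (metis less_imp_add_positive)
  \<comment> \<open>With \<open>a = 2 * s + t\<close> the bound in \<open>few\<close> becomes
    \<open>6*s*s + 2*s*t\<close>, while \<open>sum_deg_ge\<close> would require
    \<open>6*s*s + 3*s*t\<close>.\<close>
  have "0 < s * t" using t \<open>2 \<le> s\<close> by simp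
  then have "4 * (s * s) + 2 * (s * (a - s)) < 3 * a * s"
    unfolding t(1) by (simp add: algebra_simps)
  then have "\<not> 3 * a * s \<le> 2 * (\<Sum>v\<in>C \<inter> A. deg E v)" using few by linarith
  then obtain x y where "x \<in> C \<inter> A" "y \<in> C \<inter> A" "low x" "low y" "x \<noteq> y"
    using sum_deg_ge[of "C \<inter> A"] \<open>2 \<le> s\<close> by blast
  then show False using not_two_low_in_C[of x y] half by simp
qed

text \<open>Summing degrees over \<open>C\<close> counts inner arcs twice and cross arcs once; one
  of the two parts of \<open>C\<close> gets at most half of the total.\<close>

lemma not_at_most_half: "\<not> 2 * s \<le> a"
proof
  assume "2 * s \<le> a"
  then have half: "2 * s < a" using not_exactly_half by linarith
  have "(\<Sum>v\<in>C \<inter> A. deg E v) + (\<Sum>v\<in>C \<inter> B. deg E v) \<le> 4 * (s * s) + 2 * (s * (a - s))"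
    using sum_deg_C_A unmerged.sum_deg_C_A[OF swap_unmerged] num_arcs_cells_le
      cross_arcs_le cross_arcs_le_B by linarith
  then consider "2 * (\<Sum>v\<in>C \<inter> A. deg E v) \<le> 4 * (s * s) + 2 * (s * (a - s))"
    | "2 * (\<Sum>v\<in>C \<inter> B. deg E v) \<le> 4 * (s * s) + 2 * (s * (a - s))" by linarith
  then show False
    using not_small_with_few_arcs unmerged_ge_3.not_small_with_few_arcs[OF swap_ge_3] half card_C_B
    by cases simp_all
qed

end

theorem (in balanced_bipartite) hamiltonian_factor:
  assumes "3 \<le> a"
  shows "\<exists>f. cycle_factor V E f \<and> cyclic_on f V"
proof (rule ccontr)
  assume "\<not> ?thesis"
  moreover obtain f0 where "cycle_factor V E f0" using ex_cycle_factor by blast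
  moreover have "V \<noteq> {}" using card_V a_ge_2 by auto
  ultimately obtain f C where fC: "robustly_unmergeable V E f C" "2 * card C \<le> card V"
    using ex_robustly_unmergeable[OF finite_V] by blast
  interpret unmerged_ge_3 A B E a f C
    by unfold_locales (use fC assms in auto)
  show False using not_at_most_half fC(2) card_C card_V by linarith
qed

section \<open>Hamiltonian cycles\<close>

text \<open>This is \<open>K22\<close> without one 2-cycle: the ends \<open>w\<close> and
  \<open>z\<close> lie in different parts and are the pair whose two arcs are missing.\<close>

definition bidirected_path4 :: "'a set \<Rightarrow> ('a \<times> 'a) set \<Rightarrow> bool" where
  "bidirected_path4 V E \<longleftrightarrow> (\<exists>w x y z. distinct [w, x, y, z] \<and> V = {w, x, y, z} \<and>
     E = {(w, x), (x, w), (x, y), (y, x), (y, z), (z, y)})"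

context unmerged
begin

lemma path4_if_exit_from_A:
  assumes cells: "C \<inter> A = {x}" "C \<inter> B = {y}" "A - C = {u}" "B - C = {w}"
    and compl: complete_parts and xw: "(x, w) \<in> E"
  shows "bidirected_path4 V E"
proof -
  have mem: "x \<in> C \<inter> A" "w \<in> B - C" using cells by auto
  have no: "(u, y) \<notin> E" "(y, u) \<notin> E"
    using exit_from_A(1)[OF compl mem xw, of u y] cells by auto
  have wx: "(w, x) \<in> E" using exit_from_A(2)[OF compl mem xw] cells by auto
  have AB: "A = {x, u}" "B = {y, w}" using cells by auto
  have cc: "(x, y) \<in> E" "(y, x) \<in> E" "(u, w) \<in> E" "(w, u) \<in> E"
    using compl unfolding complete_parts_def cells by auto
  have "E = {(y, x), (x, y), (x, w), (w, x), (w, u), (u, w)}"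
  proof (intro equalityI subsetI)
    fix e assume "e \<in> E"
    moreover from this have "e \<in> A \<times> B \<union> B \<times> A" using arcs_sub by blast
    ultimately show "e \<in> {(y, x), (x, y), (x, w), (w, x), (w, u), (u, w)}"
      using no unfolding AB by auto
  qed (use cc xw wx in auto)
  moreover have "distinct [y, x, w, u]"
  proof -
    have "x \<noteq> u" "y \<noteq> w" using cells by auto
    moreover have "{x, u} \<inter> {y, w} = {}" using disjoint AB by simp
    ultimately show ?thesis by auto
  qed
  moreover have "V = {y, x, w, u}" using AB by auto
  ultimately show ?thesis unfolding bidirected_path4_def by blast
qed

text \<open>All four cells are singletons and \<open>f\<close> consists of two 2-cycles, so
  completeness is automatic; any arc leaving \<open>C\<close> then determines all remaining
  arcs.\<close>

lemma path4_if_order_4: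
  assumes "a = 2" "2 * s \<le> a"
  shows "bidirected_path4 V E"
proof -
  interpret sw: unmerged B A E a f C by (rule swap_unmerged)
  have s: "s = 1" using assms s_pos by linarith
  then obtain x where x: "C \<inter> A = {x}" by (auto simp: card_1_singleton_iff)
  obtain y where y: "C \<inter> B = {y}" using s card_C_B by (auto simp: card_1_singleton_iff)
  have "card (A - C) = 1" "card (B - C) = 1" using s assms card_Diff_A card_Diff_B by simp_all
  then obtain u w where u: "A - C = {u}" and w: "B - C = {w}"
    by (auto simp: card_1_singleton_iff)
  have "bij_betw f {x} {y}" "bij_betw f {y} {x}" "bij_betw f {u} {w}" "bij_betw f {w} {u}"
    using f_bij sw.f_bij f_bij_Diff sw.f_bij_Diff x y u w by simp_all
  then have "f x = y" "f y = x" "f u = w" "f w = u" by (auto simp: bij_betw_def)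
  moreover have "x \<in> V" "y \<in> V" "u \<in> V" "w \<in> V" using x y u w by auto
  ultimately have "(x, y) \<in> E" "(y, x) \<in> E" "(u, w) \<in> E" "(w, u) \<in> E"
    using factor(2) by metis+
  then have compl: complete_parts unfolding complete_parts_def x y u w by simp
  obtain p q where pq: "p \<in> C" "q \<in> V - C" "(p, q) \<in> E"
    using exit_arc[OF C_sub C_ne C_proper] .
  show ?thesis
  proof (cases "p \<in> A")
    case True
    then have "p = x" "q = w" using pq arc_A x w by blast+
    then show ?thesis using path4_if_exit_from_A[OF x y u w compl] pq by simp
  next
    case False
    then have "p = y" "q = u" using pq arc_B y u C_sub by blast+
    then show ?thesis
      using sw.path4_if_exit_from_A[OF y x w u complete_parts_swap[OF compl]] pq
      by (simp add: Un_commute)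
  qed
qed

end

lemma (in balanced_bipartite) hamiltonian_factor_or_path4:
  assumes "a = 2"
  shows "(\<exists>f. cycle_factor V E f \<and> cyclic_on f V) \<or> bidirected_path4 V E"
proof (rule ccontr)
  assume none: "\<not> ?thesis"
  obtain f0 where "cycle_factor V E f0" using ex_cycle_factor by blast
  moreover have "V \<noteq> {}" using card_V a_ge_2 by auto
  ultimately obtain f C where fC: "robustly_unmergeable V E f C" "2 * card C \<le> card V"
    using ex_robustly_unmergeable[OF finite_V] none by blast
  interpret unmerged A B E a f C by unfold_locales (rule fC)
  show False using path4_if_order_4[OF assms] fC(2) card_C card_V none by simp
qed

section \<open>From arc relations to digraphs with named arcs\<close>

lemma (in wf_digraph) hamiltonian_if_cyclic_factor:
  assumes f: "cycle_factor (verts G) (arcs_ends G) f" and cyc: "cyclic_on f (verts G)"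
  shows "hamiltonian G"
proof -
  obtain v where v: "v \<in> verts G" "verts G = orbit f v" using cyc by (auto simp: cyclic_on_def)
  have self: "v \<in> orbit f v" using v by simp
  \<comment> \<open>The least positive number of steps returning to \<open>v\<close>, that is, the
    length of the cycle.\<close>
  define n where "n = funpow_dist1 f v v"
  define w where "w i = (f ^^ i) v" for i
  have w_in: "w i \<in> verts G" for i unfolding w_def using cyclic_on_funpow_in[OF cyc v(1)] .
  have "\<forall>i. \<exists>e. e \<in> arcs G \<and> tail G e = w i \<and> head G e = w (Suc i)"
  proof
    fix i
    have "(w i, w (Suc i)) \<in> arcs_ends G" using f w_in[of i] by (simp add: cycle_factor_def w_def)
    then show "\<exists>e. e \<in> arcs G \<and> tail G e = w i \<and> head G e = w (Suc i)"
      by (auto simp: arcs_ends_conv)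
  qed
  then obtain e where e: "e i \<in> arcs G" "tail G (e i) = w i" "head G (e i) = w (Suc i)" for i
    by metis
  define p where "p = map e [0..<n]"
  have walk: "awalk v (map e [0..<k]) (w k)" for k
  proof (induction k)
    case 0
    then show ?case using v by (simp add: awalk_Nil_iff w_def)
  next
    case (Suc k)
    moreover have "awalk (w k) [e k] (w (Suc k))" using e w_in by (simp add: awalk_def)
    ultimately show ?case by (simp add: awalk_appendI)
  qed
  have n: "n > 0" and wn: "w n = v"
    using funpow_dist1_prop[OF self] by (simp_all add: n_def w_def)
  have p: "awalk v p v" "p \<noteq> []" using walk[of n] wn n by (simp_all add: p_def)
  have verts: "awalk_verts v p = v # map (\<lambda>i. w (Suc i)) [0..<n]"
    using p awalk_verts_conv'[of v p v] n e by (auto simp: awalk_def p_def hd_map w_def)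
  have inj: "inj f" using f permutes_inj by (auto simp: cycle_factor_def)
  have "inj_on w {0..<n}" using inj_on_funpow_dist1[OF self] unfolding w_def n_def .
  \<comment> \<open>\<open>cycle\<close> asks for distinctness of the vertex list without its first
    entry, which consists of the values of \<open>f \<circ> w\<close>.\<close>
  then have "inj_on (f \<circ> w) {0..<n}"
    using inj by (meson comp_inj_on inj_on_subset subset_UNIV)
  then have dist: "distinct (tl (awalk_verts v p))"
    unfolding verts by (simp add: distinct_map w_def comp_def)
  have "set (awalk_verts v p) = verts G"
  proof
    show "set (awalk_verts v p) \<subseteq> verts G" unfolding verts using w_in v by auto
    show "verts G \<subseteq> set (awalk_verts v p)"
    proof
      fix x assume "x \<in> verts G"
      then obtain i where i: "i < n" "x = w i"
        using v(2) orbit_conv_funpow_dist1[OF self] by (auto simp: n_def w_def)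
      then show "x \<in> set (awalk_verts v p)"
        unfolding verts by (cases i) (auto simp: w_def)
    qed
  qed
  then show ?thesis unfolding hamiltonian_def cycle_def using p dist by blast
qed

lemma (in nomulti_digraph) total_degree_eq_deg: "total_degree G v = deg (arcs_ends G) v"
proof -
  have "bij_betw (head G) (out_arcs G v) (arcs_ends G `` {v})"
    unfolding bij_betw_def
    using no_multi_arcs by (auto simp: inj_on_def out_arcs_def arcs_ends_conv arc_to_ends_def)
  moreover have "bij_betw (tail G) (in_arcs G v) ((arcs_ends G)\<inverse> `` {v})"
    unfolding bij_betw_def
    using no_multi_arcs by (auto simp: inj_on_def in_arcs_def arcs_ends_conv arc_to_ends_def)
  ultimately show ?thesis
    by (simp add: total_degree_def deg_def out_degree_def in_degree_def bij_betw_same_card)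
qed

lemma (in digraph) balanced_bipartite_arcs_ends:
  assumes bip: "bipartition G V\<^sub>1 V\<^sub>2" and card: "card V\<^sub>1 = a" "card V\<^sub>2 = a" "2 \<le> a"
    and sc: "strongly_connected G" and deg: "degree_sum_condition G a"
  shows "balanced_bipartite V\<^sub>1 V\<^sub>2 (arcs_ends G) a"
proof
  have V: "verts G = V\<^sub>1 \<union> V\<^sub>2" "V\<^sub>1 \<inter> V\<^sub>2 = {}" using bip by (auto simp: bipartition_def)
  then show "finite V\<^sub>1" "finite V\<^sub>2" using finite_verts by (metis finite_Un)+
  show "V\<^sub>1 \<inter> V\<^sub>2 = {}" by (rule V)
  have arc_in: "u \<in> verts G \<and> v \<in> verts G" if "(u, v) \<in> arcs_ends G" for u v
    using that adj_in_verts by blast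
  show "arcs_ends G \<subseteq> V\<^sub>1 \<times> V\<^sub>2 \<union> V\<^sub>2 \<times> V\<^sub>1"
  proof
    fix e assume "e \<in> arcs_ends G"
    then show "e \<in> V\<^sub>1 \<times> V\<^sub>2 \<union> V\<^sub>2 \<times> V\<^sub>1"
      using arc_in[of "fst e" "snd e"] bip by (cases e) (auto simp: bipartition_def)
  qed
  show "(u, v) \<in> (arcs_ends G)\<^sup>*" if "u \<in> V\<^sub>1 \<union> V\<^sub>2" "v \<in> V\<^sub>1 \<union> V\<^sub>2" for u v
    using that sc unfolding strongly_connected_def V by (intro reachable_rtranclI) blast
  show "3 * a \<le> deg (arcs_ends G) x + deg (arcs_ends G) y"
    if "partners (arcs_ends G) x y" for x y
    using that deg arc_in unfolding degree_sum_condition_def partners_def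
      common_in_neighbour_def common_out_neighbour_def total_degree_eq_deg by blast
qed (use card in auto)

text \<open>Neither side has parallel arcs, so the arc component of an isomorphism is determined by
  the vertex map and adjacency alone decides.\<close>

lemma (in nomulti_digraph) digraph_iso_with_proj_iff:
  assumes wf: "parcs H \<subseteq> pverts H \<times> pverts H"
  shows "digraph_iso G (with_proj H) \<longleftrightarrow> (\<exists>h. bij_betw h (verts G) (pverts H) \<and>
    (\<forall>u\<in>verts G. \<forall>v\<in>verts G. (u, v) \<in> arcs_ends G \<longleftrightarrow> (h u, h v) \<in> parcs H))"
    (is "_ \<longleftrightarrow> (\<exists>h. ?P h)")
proof
  assume "digraph_iso G (with_proj H)"
  then obtain hom where hom: "digraph_isomorphism hom" and H: "with_proj H = app_iso hom G"
    by (auto simp: digraph_iso_def)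
  let ?h = "iso_verts hom"
  have H': "pverts H = ?h ` verts G" "parcs H = iso_arcs hom ` arcs G"
      "fst = iso_tail hom" "snd = iso_head hom"
    using arg_cong[OF H, of verts] arg_cong[OF H, of arcs] arg_cong[OF H, of tail]
      arg_cong[OF H, of head] by simp_all
  have iso_arc: "iso_arcs hom e = (?h (tail G e), ?h (head G e))" if "e \<in> arcs G" for e
    using iso_verts_tail[OF hom that] iso_verts_head[OF hom that] unfolding H'(3,4)[symmetric]
    by (metis prod.collapse)
  have inj: "inj_on ?h (verts G)" by (rule digraph_isomorphism_inj_on_verts[OF hom])
  have "(u, v) \<in> arcs_ends G \<longleftrightarrow> (?h u, ?h v) \<in> parcs H" if "u \<in> verts G" "v \<in> verts G" for u v
  proof
    assume "(u, v) \<in> arcs_ends G"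
    then obtain e where "e \<in> arcs G" "u = tail G e" "v = head G e" by (auto simp: arcs_ends_conv)
    then show "(?h u, ?h v) \<in> parcs H" using iso_arc[of e] H'(2) by (metis imageI)
  next
    assume "(?h u, ?h v) \<in> parcs H"
    then obtain e where e: "e \<in> arcs G" "(?h u, ?h v) = (?h (tail G e), ?h (head G e))"
      using iso_arc H'(2) by fastforce
    then have "u = tail G e" "v = head G e" using inj that by (auto dest: inj_onD)
    then show "(u, v) \<in> arcs_ends G" using e(1) by (auto simp: arcs_ends_conv)
  qed
  then show "\<exists>h. ?P h" using inj H'(1) by (intro exI[of _ ?h]) (auto simp: bij_betw_def)
next
  assume "\<exists>h. ?P h"
  then obtain h where h: "?P h" by blast
  then have inj: "inj_on h (verts G)" and img: "h ` verts G = pverts H" by (auto simp: bij_betw_def)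
  \<comment> \<open>Arcs of \<open>with_proj H\<close> are pairs with projections \<open>fst\<close>
    and \<open>snd\<close>, so an arc must go to the pair of images of its ends.\<close>
  let ?hom = "\<lparr> iso_verts = h, iso_arcs = \<lambda>e. (h (tail G e), h (head G e)),
    iso_head = snd, iso_tail = fst \<rparr>"
  have "digraph_isomorphism ?hom"
    unfolding digraph_isomorphism_def
  proof (intro conjI)
    show "inj_on (iso_arcs ?hom) (arcs G)"
    proof (rule inj_onI)
      fix e e' assume ee: "e \<in> arcs G" "e' \<in> arcs G" "iso_arcs ?hom e = iso_arcs ?hom e'"
      then have "tail G e = tail G e'" "head G e = head G e'"
        using inj by (auto dest: inj_onD)
      then show "e = e'" using no_multi_arcs ee by (simp add: arc_to_ends_def)
    qed
  qed (use inj wf_digraph in auto)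
  moreover have "(\<lambda>e. (h (tail G e), h (head G e))) ` arcs G = parcs H"
  proof (intro equalityI subsetI)
    fix c assume "c \<in> (\<lambda>e. (h (tail G e), h (head G e))) ` arcs G"
    then obtain e where "e \<in> arcs G" "c = (h (tail G e), h (head G e))" by blast
    moreover from this have "(tail G e, head G e) \<in> arcs_ends G" by (auto simp: arcs_ends_conv)
    ultimately show "c \<in> parcs H" using h by simp
  next
    fix c assume c: "c \<in> parcs H"
    then obtain u v where uv: "u \<in> verts G" "v \<in> verts G" "c = (h u, h v)"
      using wf img by blast
    then have "(u, v) \<in> arcs_ends G" using h c by blast
    then show "c \<in> (\<lambda>e. (h (tail G e), h (head G e))) ` arcs G"
      using uv(3) by (auto simp: arcs_ends_conv)
  qed
  ultimately show "digraph_iso G (with_proj H)"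
    using img unfolding digraph_iso_def by (intro exI[of _ ?hom]) (simp add: app_iso_def with_proj_def)
qed

section \<open>The exceptional digraph on four vertices\<close>

lemma parcs_K22_minus_2cycle:
  "parcs K22_minus_2cycle = {(0, 3), (3, 0), (3, 1), (1, 3), (1, 2), (2, 1)}"
  "pverts K22_minus_2cycle = {0, 3, 1, 2}"
  by (auto simp: K22_minus_2cycle_def K22_def)

lemma (in digraph) digraph_iso_K22_minus_2cycle_iff:
  "digraph_iso G (with_proj K22_minus_2cycle) \<longleftrightarrow> bidirected_path4 (verts G) (arcs_ends G)"
proof -
  let ?K = "K22_minus_2cycle"
  have wf: "parcs ?K \<subseteq> pverts ?K \<times> pverts ?K" by (auto simp: parcs_K22_minus_2cycle)
  have arc_in: "u \<in> verts G \<and> v \<in> verts G" if "(u, v) \<in> arcs_ends G" for u v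
    using that adj_in_verts by blast
  show ?thesis
    unfolding digraph_iso_with_proj_iff[OF wf]
  proof
    assume "\<exists>h. bij_betw h (verts G) (pverts ?K) \<and>
      (\<forall>u\<in>verts G. \<forall>v\<in>verts G. (u, v) \<in> arcs_ends G \<longleftrightarrow> (h u, h v) \<in> parcs ?K)"
    then obtain h where h: "bij_betw h (verts G) (pverts ?K)"
      and arcs: "\<And>u v. u \<in> verts G \<Longrightarrow> v \<in> verts G \<Longrightarrow> (u, v) \<in> arcs_ends G \<longleftrightarrow> (h u, h v) \<in> parcs ?K"
      by blast
    define g where "g = the_inv_into (verts G) h"
    have g: "bij_betw g (pverts ?K) (verts G)" and hg: "\<And>k. k \<in> pverts ?K \<Longrightarrow> h (g k) = k"
      unfolding g_def using h by (auto simp: bij_betw_the_inv_into f_the_inv_into_f_bij_betw)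
    have V: "verts G = {g 0, g 3, g 1, g 2}" using g by (auto simp: bij_betw_def parcs_K22_minus_2cycle)
    have hg': "h (g 0) = 0" "h (g 1) = 1" "h (g 2) = 2" "h (g 3) = 3"
      using hg by (simp_all add: parcs_K22_minus_2cycle)
    have dist: "distinct [g 0, g 3, g 1, g 2]" using hg' by auto
    have "arcs_ends G = {(g 0, g 3), (g 3, g 0), (g 3, g 1), (g 1, g 3), (g 1, g 2), (g 2, g 1)}"
    proof (intro equalityI subsetI)
      fix c assume c: "c \<in> arcs_ends G"
      obtain u v where uv: "c = (u, v)" by (cases c)
      have uvV: "u \<in> verts G" "v \<in> verts G" using arc_in c uv by auto
      then have "(h u, h v) \<in> parcs ?K" using arcs c uv by blast
      then show "c \<in> {(g 0, g 3), (g 3, g 0), (g 3, g 1), (g 1, g 3), (g 1, g 2), (g 2, g 1)}"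
        using uvV uv hg' unfolding V by (auto simp: parcs_K22_minus_2cycle)
    qed (use arcs hg' V in \<open>auto simp: parcs_K22_minus_2cycle\<close>)
    then show "bidirected_path4 (verts G) (arcs_ends G)"
      unfolding bidirected_path4_def using V dist by blast
  next
    assume "bidirected_path4 (verts G) (arcs_ends G)"
    then obtain w x y z where dist: "distinct [w, x, y, z]" and V: "verts G = {w, x, y, z}"
      and E: "arcs_ends G = {(w, x), (x, w), (x, y), (y, x), (y, z), (z, y)}"
      unfolding bidirected_path4_def by blast
    \<comment> \<open>The values 0, 3, 1, 2 follow the path in \<open>K22_minus_2cycle\<close>,
      whose ends 0 and 2 are the pair separated by the removal.\<close>
    define h :: "'a \<Rightarrow> nat"
      where "h v = (if v = w then 0 else if v = x then 3 else if v = y then 1 else 2)" for v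
    have h: "h w = 0" "h x = 3" "h y = 1" "h z = 2" using dist by (auto simp: h_def)
    have "bij_betw h (verts G) (pverts ?K)"
      unfolding bij_betw_def V parcs_K22_minus_2cycle using h by (auto simp: inj_on_def)
    moreover have "\<forall>u\<in>verts G. \<forall>v\<in>verts G. (u, v) \<in> arcs_ends G \<longleftrightarrow> (h u, h v) \<in> parcs ?K"
      unfolding V E parcs_K22_minus_2cycle using h dist by auto
    ultimately show "\<exists>h. bij_betw h (verts G) (pverts ?K) \<and>
      (\<forall>u\<in>verts G. \<forall>v\<in>verts G. (u, v) \<in> arcs_ends G \<longleftrightarrow> (h u, h v) \<in> parcs ?K)" by blast
  qed
qed

text \<open>An end of the path can be entered and left only through its single neighbour, which a
  cycle on four vertices would then visit twice.\<close>

lemma (in digraph) path4_not_hamiltonian: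
  assumes "bidirected_path4 (verts G) (arcs_ends G)"
  shows "\<not> hamiltonian G"
proof
  assume "hamiltonian G"
  then obtain u p where cyc: "cycle p" and walk: "awalk u p u"
    and all: "set (awalk_verts u p) = verts G"
    unfolding hamiltonian_def by blast
  obtain w x y z where dist: "distinct [w, x, y, z]" and V: "verts G = {w, x, y, z}"
    and E: "arcs_ends G = {(w, x), (x, w), (x, y), (y, x), (y, z), (z, y)}"
    using assms unfolding bidirected_path4_def by blast
  have ne: "p \<noteq> []" using cyc by (auto simp: cycle_def)
  \<comment> \<open>\<open>cycle\<close> provides some base vertex \<open>t\<close>; the vertex list
    of a nonempty walk does not depend on it, so \<open>u\<close> can replace it.\<close>
  obtain t where "distinct (tl (awalk_verts t p))" using cyc by (auto simp: cycle_def)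
  then have d: "distinct (tl (awalk_verts u p))" using awalk_verts_ne_eq[OF ne, of u t] by simp
  have conv: "awalk_verts u p = tail G (hd p) # map (head G) p"
    using awalk_verts_conv'[of u p u] walk ne by (simp add: awalk_def)
  have heads: "distinct (map (head G) p)" using d conv by simp
  have "awlast u p = u" "awhd u p = u" using walk by auto
  then have "u \<in> set (map (head G) p)" "tail G (hd p) = u" using conv ne by (auto simp: last_map)
  then have "set (map (head G) p) = verts G" using all conv by auto
  then have "length p = card (verts G)" using distinct_card[OF heads] by simp
  then have "length p = 4" using V dist by simp
  then obtain e1 e2 e3 e4 where p: "p = [e1, e2, e3, e4]"
    by (auto simp: length_Suc_conv numeral_eq_Suc)
  have arc: "(tail G e, head G e) \<in> arcs_ends G" if "e \<in> set p" for e
    using walk that by (auto simp: awalk_def arcs_ends_conv)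
  have steps: "tail G e1 = u" "tail G e2 = head G e1" "tail G e3 = head G e2"
    "tail G e4 = head G e3" "head G e4 = u"
    using walk p by (auto simp: awalk_def)
  show False
    using arc[of e1] arc[of e2] arc[of e3] arc[of e4] heads dist steps unfolding p E by auto
qed

lemma (in digraph) path4_properties:
  assumes "bidirected_path4 (verts G) (arcs_ends G)"
  shows "\<exists>V\<^sub>1 V\<^sub>2. bipartition G V\<^sub>1 V\<^sub>2 \<and> card V\<^sub>1 = 2 \<and> card V\<^sub>2 = 2"
    and "strongly_connected G" and "degree_sum_condition G 2"
proof -
  obtain w x y z where dist: "distinct [w, x, y, z]" and V: "verts G = {w, x, y, z}"
    and E: "arcs_ends G = {(w, x), (x, w), (x, y), (y, x), (y, z), (z, y)}"
    using assms unfolding bidirected_path4_def by blast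
  show "\<exists>V\<^sub>1 V\<^sub>2. bipartition G V\<^sub>1 V\<^sub>2 \<and> card V\<^sub>1 = 2 \<and> card V\<^sub>2 = 2"
    using dist by (intro exI[of _ "{w, y}"] exI[of _ "{x, z}"]) (auto simp: bipartition_def V E)
  have reach: "w \<rightarrow>\<^sup>* x" "x \<rightarrow>\<^sup>* w" "x \<rightarrow>\<^sup>* y" "y \<rightarrow>\<^sup>* x" "y \<rightarrow>\<^sup>* z" "z \<rightarrow>\<^sup>* y"
    by (rule reachable_adjI, simp add: E)+
  then have "w \<rightarrow>\<^sup>* y" "y \<rightarrow>\<^sup>* w" "x \<rightarrow>\<^sup>* z" "z \<rightarrow>\<^sup>* x" by (blast intro: reachable_trans)+
  moreover from this reach have "w \<rightarrow>\<^sup>* z" "z \<rightarrow>\<^sup>* w" by (blast intro: reachable_trans)+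
  ultimately show "strongly_connected G"
    using reach reachable_refl unfolding strongly_connected_def V by auto
  have "arcs_ends G `` {w} = {x}" "arcs_ends G `` {x} = {w, y}" "arcs_ends G `` {y} = {x, z}"
      "arcs_ends G `` {z} = {y}" "(arcs_ends G)\<inverse> = arcs_ends G"
    using dist by (auto simp: E)
  then have deg: "deg (arcs_ends G) w = 2" "deg (arcs_ends G) x = 4"
      "deg (arcs_ends G) y = 4" "deg (arcs_ends G) z = 2"
    using dist by (simp_all add: deg_def)
  \<comment> \<open>Only the pairs \<open>w, y\<close> and \<open>x, z\<close> have a common
    neighbour, and both degree sums are exactly \<open>2 + 4 = 3 * 2\<close>.\<close>
  show "degree_sum_condition G 2"
    unfolding degree_sum_condition_def total_degree_eq_deg V common_in_neighbour_def
      common_out_neighbour_def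
    using dist by (auto simp: deg[unfolded E] E)
qed

theorem theorem1p2:
  fixes D :: "('a,'b) pre_digraph"
  assumes "digraph D"
  shows "(\<forall>V\<^sub>1 V\<^sub>2 a. a \<ge> 3 \<and> bipartition D V\<^sub>1 V\<^sub>2 \<and> card V\<^sub>1 = a \<and> card V\<^sub>2 = a
            \<and> strongly_connected D \<and> degree_sum_condition D a
          \<longrightarrow> hamiltonian D)
       \<and> ((\<exists>V\<^sub>1 V\<^sub>2. bipartition D V\<^sub>1 V\<^sub>2 \<and> card V\<^sub>1 = 2 \<and> card V\<^sub>2 = 2)
            \<and> strongly_connected D \<and> degree_sum_condition D 2 \<and> \<not> hamiltonian D
          \<longleftrightarrow> digraph_iso D (with_proj K22_minus_2cycle))"
proof -
  interpret digraph D by (rule assms)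
  have verts: "verts D = V\<^sub>1 \<union> V\<^sub>2" if "bipartition D V\<^sub>1 V\<^sub>2" for V\<^sub>1 V\<^sub>2
    using that by (simp add: bipartition_def)
  show ?thesis
  proof (intro conjI allI impI iffI)
    fix V\<^sub>1 V\<^sub>2 :: "'a set" and a :: nat
    assume h: "a \<ge> 3 \<and> bipartition D V\<^sub>1 V\<^sub>2 \<and> card V\<^sub>1 = a \<and> card V\<^sub>2 = a
      \<and> strongly_connected D \<and> degree_sum_condition D a"
    then interpret balanced_bipartite V\<^sub>1 V\<^sub>2 "arcs_ends D" a
      by (intro balanced_bipartite_arcs_ends) auto
    show "hamiltonian D"
      using hamiltonian_factor h hamiltonian_if_cyclic_factor verts[of V\<^sub>1 V\<^sub>2] by auto
  next
    assume h: "(\<exists>V\<^sub>1 V\<^sub>2. bipartition D V\<^sub>1 V\<^sub>2 \<and> card V\<^sub>1 = 2 \<and> card V\<^sub>2 = 2)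
      \<and> strongly_connected D \<and> degree_sum_condition D 2 \<and> \<not> hamiltonian D"
    then obtain V\<^sub>1 V\<^sub>2 where bip: "bipartition D V\<^sub>1 V\<^sub>2" "card V\<^sub>1 = 2" "card V\<^sub>2 = 2" by blast
    then interpret balanced_bipartite V\<^sub>1 V\<^sub>2 "arcs_ends D" 2
      using h by (intro balanced_bipartite_arcs_ends) auto
    have "bidirected_path4 (verts D) (arcs_ends D)"
      using hamiltonian_factor_or_path4 hamiltonian_if_cyclic_factor h verts[OF bip(1)] by auto
    then show "digraph_iso D (with_proj K22_minus_2cycle)"
      by (simp add: digraph_iso_K22_minus_2cycle_iff)
  next
    assume "digraph_iso D (with_proj K22_minus_2cycle)"
    then have path: "bidirected_path4 (verts D) (arcs_ends D)"
      by (simp add: digraph_iso_K22_minus_2cycle_iff)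
    show "\<exists>V\<^sub>1 V\<^sub>2. bipartition D V\<^sub>1 V\<^sub>2 \<and> card V\<^sub>1 = 2 \<and> card V\<^sub>2 = 2"
        "strongly_connected D" "degree_sum_condition D 2"
      by (rule path4_properties[OF path])+
    show "\<not> hamiltonian D" by (rule path4_not_hamiltonian[OF path])
  qed
qed

end
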